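(* Let $A$ be a nontrivial closed class of decision tables from $\mathcal M_2^\infty$, let $\psi$ be a bounded complexity measure, and suppose $\mathcal H^\infty_{\psi,A}$ is everywhere defined. Then there exists a polynomial $p_0$ with $\mathcal H^\infty_{\psi,A}(n)\le p_0(n)$ for all $n\in\omega$ if and only if there exist polynomials $p_1,p_2,p_3$ such that, for all $n\in\omega$, $Z_{\psi,A}(n)\le p_1(n)$, $G_{\psi,A}(n)\le p_2(n)$ and $L_{\psi,A}(n)\le 2^{p_3(n)}$ (in particular these three functions are defined everywhere).
   Context: Notation: $\omega=\{0,1,2,\dots\}$; $\mathcal P(\omega)$ is the set of nonempty finite subsets of $\omega$; $E_2=\{0,1\}$. $P=\{f_i:i\in\omega\}$ is a set of attributes, $f_i\neq f_j$ for $i\ne j$. Decision tables: $\mathcal M_2^\infty$ is the set of rectangular tables filled with numbers from $E_2$, whose columns are labeled with pairwise different attributes from $P$, whose rows are pairwise different, and each row of which is labeled with a set from $\mathcal P(\omega)$ (its set of decisions). The empty table (no rows) is denoted $\Lambda$ and belongs to $\mathcal M_2^\infty$. For $T\in\mathcal M_2^\infty$: $\Delta(T)$ is the set of rows; $\Pi(T)$ is the intersection of the decision sets of all rows (common decisions); $\mathrm{At}(T)$ is the set of attributes labeling columns; $N(T)$ is the number of rows. For nonempty $T$, $\Omega_2(T)$ is the set of finite words (including the empty word $\lambda$) over the alphabet $\{(f_i,\delta):f_i\in\mathrm{At}(T),\delta\in E_2\}$; for $\alpha=(f_{i_1},\delta_1)\cdots(f_{i_m},\delta_m)$, $T\alpha$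 is the subtable of $T$ consisting of the rows having value $\delta_j$ in the column $f_{i_j}$ for all $j$, and $T\lambda=T$. Operations: for $D\subseteq\mathrm{At}(T)$, $I(D,T)$ is obtained from $T$ by deleting the columns labeled with attributes from $D$ and, in each group of rows coinciding on the remaining columns, keeping only the first row; $I(\mathrm{At}(T),T)=\Lambda$. For $\nu:E_2^{|\mathrm{At}(T)|}\to\mathcal P(\omega)$, $J(\nu,T)$ is obtained by replacing the decision set of each row $\bar\delta$ by $\nu(\bar\delta)$. $[T]=\{J(\nu,I(D,T)):D\subseteq\mathrm{At}(T),\ \nu:E_2^{|\mathrm{At}(T)\setminus D|}\to\mathcal P(\omega)\}$; for nonempty $A\subseteq\mathcal M_2^\infty$, $[A]=\bigcup_{T\in A}[T]$. $A$ is a closed class if $[A]=A$; nontrivial if it contains a nonempty table. Decision trees: a $2$-decision tree is a finite directed rooted tree with at least two nodes in which the root and the edges leaving the root are unlabeled, each terminal node is labeled with a decision from $\omega$, and each other node is labeled with an attribute from $P$, each edge leaving such a node being labeled with a number from $E_2$. $\mathrm{At}(\Gamma)$ is the set of attributes labeling nodes of $\Gamma$. For a complete path $\tau=v_1,d_1,\dots,v_m,d_m,v_{m+1}$ (from the root to a terminal node), $\pi(\tau)=\lambda$ if $m=1$, and otherwise $\pi(\tau)=(f_{i_2},\delta_2)\cdots(f_{i_m},\delta_m)$ where $v_j$ is labeled $f_{i_j}$ and $d_j$ is labeled $\delta_j$; $T(\tau)=T\pi(\tau)$. For $T\ne\Lambda$, a nondeterministic decision tree for $T$ is a $2$-decision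 tree $\Gamma$ with $\mathrm{At}(\Gamma)\subseteq\mathrm{At}(T)$ such that every row of $T$ belongs to $T(\tau)$ for some complete path $\tau$, and for every complete path $\tau$ either $T(\tau)=\Lambda$ or the decision at the terminal node of $\tau$ belongs to $\Pi(T(\tau))$. A deterministic decision tree for $T$ is a nondeterministic decision tree for $T$ in which, additionally, exactly one edge leaves the root and the edges leaving any node that is neither the root nor terminal are labeled with pairwise different numbers. Complexity measures: a partially bounded complexity measure is a function $\psi:P^*\to\omega$ on finite words over $P$ such that for all words $\alpha_1,\alpha_2$: $\psi(\alpha_1)=0$ iff $\alpha_1=\lambda$; $\psi(\alpha_1)$ is invariant under permutation of letters; $\psi(\alpha_1)\le\psi(\alpha_1\alpha_2)$; $\psi(\alpha_1\alpha_2)\le\psi(\alpha_1)+\psi(\alpha_2)$. It is bounded if in addition $\psi(\alpha)\ge|\alpha|$ for all $\alpha$. $\psi$ is extended to words $(f_{i_1},\delta_1)\cdots(f_{i_m},\delta_m)$ by $\psi(f_{i_1}\cdots f_{i_m})$ ($\psi(\lambda)=0$). For a $2$-decision tree $\Gamma$, $\psi(\Gamma)=\max_\tau\psi(\pi(\tau))$ over complete paths. For $T\ne\Lambda$, $\psi^d(T)$ (resp. $\psi^a(T)$) is the minimum of $\psi(\Gamma)$ over deterministic (resp. nondeterministic) decision trees $\Gamma$ for $T$; $\psi^d(\Lambda)=\psi^a(\Lambda)=0$. Parameters: $m_\psi(T)=\max\{\psi(f_i):f_i\in\mathrm{At}(T)\}$, $m_\psi(\Lambda)=0$. A table $Q\in\mathcal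 M_2^\infty$ is complete if $N(Q)=2^{|\mathrm{At}(Q)|}$; $Z(T)$ is the maximum number of columns of a complete table in $[T]$ if such tables exist, and $0$ otherwise; $Z(\Lambda)=0$. A word $\alpha\in\Omega_2(T)$ is annihilating for $T$ if $T\alpha=\Lambda$ and $\alpha$ contains no two letters $(f_i,\delta),(f_i,\sigma)$ with $\delta\ne\sigma$; it is irreducible if no word obtained from $\alpha$ by deleting some (at least one) letters is annihilating; $G(T)$ is the maximum length of an irreducible annihilating word for $T$ if one exists, and $0$ otherwise; $G(\Lambda)=0$. For $T\ne\Lambda$, $n\in\omega$: $\Omega_2^n(T)=\{\alpha\in\Omega_2(T):\psi(\alpha)\le n\}$; a finite $U\subseteq\Omega_2^n(T)$ is a $(\psi,n)$-cover of $T$ if $\bigcup_{\alpha\in U}\Delta(T\alpha)=\Delta(T)$, irreducible if no proper subset is a $(\psi,n)$-cover; $l_\psi(T,n)$ is the maximum cardinality of an irreducible $(\psi,n)$-cover of $T$; $l_\psi(\Lambda,n)=0$. Class functions ($n\in\omega$): $A_\psi(n)=\{T\in A:m_\psi(T)\le n\}$. $Z_{\psi,A}(n)$ is undefined if $\{Z(T):T\in A_\psi(n)\}$ is infinite, else its maximum; $G_{\psi,A}(n)$ is undefined if $\{G(T):T\in A_\psi(n)\}$ is infinite, else its maximum; $L_{\psi,A}(n)$ is undefined if $\{l_\psi(T,n):T\in A\}$ is infinite, else its maximum; $\mathcal H^\infty_{\psi,A}(n)$ is undefined if $\{\psi^d(T):T\in A,\psi^a(T)\le n\}$ is infinite, else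 its maximum. *)

theory Defs
  imports "HOL-Library.Multiset" "HOL-Library.Sublist" "HOL-Computational_Algebra.Polynomial"
begin

record dtable =
  cols :: "nat set"
  rows :: "(nat \<Rightarrow> nat) set"
  dec  :: "(nat \<Rightarrow> nat) \<Rightarrow> nat set"

definition E2 :: "nat set" where "E2 = {0, 1}"

definition Pw :: "nat set set" where "Pw = {S. finite S \<and> S \<noteq> {}}"

definition is_table :: "dtable \<Rightarrow> bool" where
  "is_table T \<longleftrightarrow> finite (cols T) \<and> finite (rows T)
     \<and> (\<forall>r\<in>rows T. (\<forall>i\<in>cols T. r i \<in> E2) \<and> (\<forall>i. i \<notin> cols T \<longrightarrow> r i = 0))
     \<and> (\<forall>r\<in>rows T. dec T r \<in> Pw)
     \<and> (\<forall>r. r \<notin> rows T \<longrightarrow> dec T r = {})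
     \<and> (rows T = {} \<longleftrightarrow> cols T = {})"

definition Lam :: dtable where
  "Lam = \<lparr>cols = {}, rows = {}, dec = (\<lambda>_. {})\<rparr>"

definition Ntab :: "dtable \<Rightarrow> nat" where "Ntab T = card (rows T)"

definition Pi_tab :: "dtable \<Rightarrow> nat set" where
  "Pi_tab T = (\<Inter>r\<in>rows T. dec T r)"

type_synonym word = "(nat \<times> nat) list"

definition Omega2 :: "dtable \<Rightarrow> word set" where
  "Omega2 T = {\<alpha>. \<forall>(i, d)\<in>set \<alpha>. i \<in> cols T \<and> d \<in> E2}"

definition sub_rows :: "dtable \<Rightarrow> word \<Rightarrow> (nat \<Rightarrow> nat) set" where
  "sub_rows T \<alpha> = {r \<in> rows T. \<forall>(i, d)\<in>set \<alpha>. r i = d}"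

definition proj :: "nat set \<Rightarrow> (nat \<Rightarrow> nat) \<Rightarrow> (nat \<Rightarrow> nat)" where
  "proj D r = (\<lambda>i. if i \<in> D then 0 else r i)"

text \<open>[T] = { J(nu, I(D,T)) }.  For D = At(T), I(D,T) = Lambda and J(nu,Lambda) = Lambda.
  For D a proper subset, I(D,T) has columns At(T) - D and the projections of the rows of T
  as rows; J(nu, -) then assigns an arbitrary decision set from P(omega) to every row
  (so which representative row is kept by I is irrelevant).\<close>
definition bracket :: "dtable \<Rightarrow> dtable set" where
  "bracket T = {T'. \<exists>D. D \<subseteq> cols T \<and>
      ((D = cols T \<and> T' = Lam) \<or>
       (D \<noteq> cols T \<and> cols T' = cols T - D \<and> rows T' = proj D ` rows T
        \<and> (\<forall>r\<in>rows T'. dec T' r \<in> Pw) \<and> (\<forall>r. r \<notin> rows T' \<longrightarrow> dec T' r = {})))}"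

definition bracket_class :: "dtable set \<Rightarrow> dtable set" where
  "bracket_class A = (\<Union>T\<in>A. bracket T)"

definition closed_class :: "dtable set \<Rightarrow> bool" where
  "closed_class A \<longleftrightarrow> A \<noteq> {} \<and> (\<forall>T\<in>A. is_table T) \<and> bracket_class A = A"

definition nontrivial :: "dtable set \<Rightarrow> bool" where
  "nontrivial A \<longleftrightarrow> (\<exists>T\<in>A. rows T \<noteq> {})"

text \<open>A node below the root: either a terminal node labelled with a decision, or a node
  labelled with an attribute f_i together with its outgoing edges (edge label, subtree).
  A 2-decision tree is given by the (unlabelled) list of edges leaving the root.\<close>
datatype dnode = Leaf nat | Node nat "(nat \<times> dnode) list"

type_synonym dtree = "dnode list"

fun wf_node :: "dnode \<Rightarrow> bool" where
  "wf_node (Leaf d) = True"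
| "wf_node (Node i cs) = (cs \<noteq> [] \<and> (\<forall>x\<in>set cs. fst x \<in> E2 \<and> wf_node (snd x)))"

definition wf_tree :: "dtree \<Rightarrow> bool" where
  "wf_tree \<Gamma> \<longleftrightarrow> \<Gamma> \<noteq> [] \<and> (\<forall>c\<in>set \<Gamma>. wf_node c)"

fun attrs_node :: "dnode \<Rightarrow> nat set" where
  "attrs_node (Leaf d) = {}"
| "attrs_node (Node i cs) = insert i (\<Union>x\<in>set cs. attrs_node (snd x))"

definition attrs_tree :: "dtree \<Rightarrow> nat set" where
  "attrs_tree \<Gamma> = (\<Union>c\<in>set \<Gamma>. attrs_node c)"

fun paths_node :: "dnode \<Rightarrow> (word \<times> nat) list" where
  "paths_node (Leaf d) = [([], d)]"
| "paths_node (Node i cs) =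
     concat (map (\<lambda>x. map (\<lambda>p. ((i, fst x) # fst p, snd p)) (paths_node (snd x))) cs)"

definition paths_tree :: "dtree \<Rightarrow> (word \<times> nat) list" where
  "paths_tree \<Gamma> = concat (map paths_node \<Gamma>)"

fun det_node :: "dnode \<Rightarrow> bool" where
  "det_node (Leaf d) = True"
| "det_node (Node i cs) = (distinct (map fst cs) \<and> (\<forall>x\<in>set cs. det_node (snd x)))"

definition nondet_tree_for :: "dtable \<Rightarrow> dtree \<Rightarrow> bool" where
  "nondet_tree_for T \<Gamma> \<longleftrightarrow> wf_tree \<Gamma> \<and> attrs_tree \<Gamma> \<subseteq> cols T
     \<and> (\<forall>r\<in>rows T. \<exists>p\<in>set (paths_tree \<Gamma>). r \<in> sub_rows T (fst p))
     \<and> (\<forall>p\<in>set (paths_tree \<Gamma>). sub_rows T (fst p) = {}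
           \<or> snd p \<in> (\<Inter>r\<in>sub_rows T (fst p). dec T r))"

definition det_tree_for :: "dtable \<Rightarrow> dtree \<Rightarrow> bool" where
  "det_tree_for T \<Gamma> \<longleftrightarrow> nondet_tree_for T \<Gamma> \<and> length \<Gamma> = 1 \<and> (\<forall>c\<in>set \<Gamma>. det_node c)"

definition partially_bounded_cm :: "(nat list \<Rightarrow> nat) \<Rightarrow> bool" where
  "partially_bounded_cm \<psi> \<longleftrightarrow>
     (\<forall>\<alpha>. \<psi> \<alpha> = 0 \<longleftrightarrow> \<alpha> = [])
   \<and> (\<forall>\<alpha> \<beta>. mset \<alpha> = mset \<beta> \<longrightarrow> \<psi> \<alpha> = \<psi> \<beta>)
   \<and> (\<forall>\<alpha>1 \<alpha>2. \<psi> \<alpha>1 \<le> \<psi> (\<alpha>1 @ \<alpha>2))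
   \<and> (\<forall>\<alpha>1 \<alpha>2. \<psi> (\<alpha>1 @ \<alpha>2) \<le> \<psi> \<alpha>1 + \<psi> \<alpha>2)"

definition bounded_cm :: "(nat list \<Rightarrow> nat) \<Rightarrow> bool" where
  "bounded_cm \<psi> \<longleftrightarrow> partially_bounded_cm \<psi> \<and> (\<forall>\<alpha>. length \<alpha> \<le> \<psi> \<alpha>)"

definition psi_w :: "(nat list \<Rightarrow> nat) \<Rightarrow> word \<Rightarrow> nat" where
  "psi_w \<psi> \<alpha> = \<psi> (map fst \<alpha>)"

definition psi_tree :: "(nat list \<Rightarrow> nat) \<Rightarrow> dtree \<Rightarrow> nat" where
  "psi_tree \<psi> \<Gamma> = Max ((\<lambda>p. psi_w \<psi> (fst p)) ` set (paths_tree \<Gamma>))"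

definition psi_d :: "(nat list \<Rightarrow> nat) \<Rightarrow> dtable \<Rightarrow> nat" where
  "psi_d \<psi> T = (if rows T = {} then 0 else (LEAST k. \<exists>\<Gamma>. det_tree_for T \<Gamma> \<and> psi_tree \<psi> \<Gamma> = k))"

definition psi_a :: "(nat list \<Rightarrow> nat) \<Rightarrow> dtable \<Rightarrow> nat" where
  "psi_a \<psi> T = (if rows T = {} then 0 else (LEAST k. \<exists>\<Gamma>. nondet_tree_for T \<Gamma> \<and> psi_tree \<psi> \<Gamma> = k))"

definition m_psi :: "(nat list \<Rightarrow> nat) \<Rightarrow> dtable \<Rightarrow> nat" where
  "m_psi \<psi> T = (if cols T = {} then 0 else Max ((\<lambda>i. \<psi> [i]) ` cols T))"

definition complete_tab :: "dtable \<Rightarrow> bool" where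
  "complete_tab Q \<longleftrightarrow> Ntab Q = 2 ^ card (cols Q)"

definition Zpar :: "dtable \<Rightarrow> nat" where
  "Zpar T = (if rows T = {} then 0 else
     (if (\<exists>Q\<in>bracket T. complete_tab Q)
      then Max {card (cols Q) | Q. Q \<in> bracket T \<and> complete_tab Q} else 0))"

definition annihilating :: "dtable \<Rightarrow> word \<Rightarrow> bool" where
  "annihilating T \<alpha> \<longleftrightarrow> \<alpha> \<in> Omega2 T \<and> sub_rows T \<alpha> = {}
     \<and> \<not> (\<exists>i d s. (i, d) \<in> set \<alpha> \<and> (i, s) \<in> set \<alpha> \<and> d \<noteq> s)"

text \<open>Words obtained from alpha by deleting at least one letter are exactly the proper
  subsequences of alpha.\<close>
definition irreducible_ann :: "dtable \<Rightarrow> word \<Rightarrow> bool" where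
  "irreducible_ann T \<alpha> \<longleftrightarrow> annihilating T \<alpha>
     \<and> (\<forall>\<beta>. subseq \<beta> \<alpha> \<and> length \<beta> < length \<alpha> \<longrightarrow> \<not> annihilating T \<beta>)"

definition Gpar :: "dtable \<Rightarrow> nat" where
  "Gpar T = (if rows T = {} then 0 else
     (if (\<exists>\<alpha>. irreducible_ann T \<alpha>)
      then Max {length \<alpha> | \<alpha>. irreducible_ann T \<alpha>} else 0))"

definition Omega2n :: "(nat list \<Rightarrow> nat) \<Rightarrow> dtable \<Rightarrow> nat \<Rightarrow> word set" where
  "Omega2n \<psi> T n = {\<alpha> \<in> Omega2 T. psi_w \<psi> \<alpha> \<le> n}"

definition is_cover :: "(nat list \<Rightarrow> nat) \<Rightarrow> dtable \<Rightarrow> nat \<Rightarrow> word set \<Rightarrow> bool" where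
  "is_cover \<psi> T n U \<longleftrightarrow> finite U \<and> U \<subseteq> Omega2n \<psi> T n
     \<and> (\<Union>\<alpha>\<in>U. sub_rows T \<alpha>) = rows T"

definition irreducible_cover :: "(nat list \<Rightarrow> nat) \<Rightarrow> dtable \<Rightarrow> nat \<Rightarrow> word set \<Rightarrow> bool" where
  "irreducible_cover \<psi> T n U \<longleftrightarrow> is_cover \<psi> T n U \<and> (\<forall>V. V \<subset> U \<longrightarrow> \<not> is_cover \<psi> T n V)"

definition l_psi :: "(nat list \<Rightarrow> nat) \<Rightarrow> dtable \<Rightarrow> nat \<Rightarrow> nat" where
  "l_psi \<psi> T n = (if rows T = {} then 0 else
     Max {card U | U. irreducible_cover \<psi> T n U})"

definition max_if_finite :: "nat set \<Rightarrow> nat option" where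
  "max_if_finite S = (if finite S then Some (Max S) else None)"

definition A_psi :: "(nat list \<Rightarrow> nat) \<Rightarrow> dtable set \<Rightarrow> nat \<Rightarrow> dtable set" where
  "A_psi \<psi> A n = {T \<in> A. m_psi \<psi> T \<le> n}"

definition Z_fun :: "(nat list \<Rightarrow> nat) \<Rightarrow> dtable set \<Rightarrow> nat \<Rightarrow> nat option" where
  "Z_fun \<psi> A n = max_if_finite (Zpar ` A_psi \<psi> A n)"

definition G_fun :: "(nat list \<Rightarrow> nat) \<Rightarrow> dtable set \<Rightarrow> nat \<Rightarrow> nat option" where
  "G_fun \<psi> A n = max_if_finite (Gpar ` A_psi \<psi> A n)"

definition L_fun :: "(nat list \<Rightarrow> nat) \<Rightarrow> dtable set \<Rightarrow> nat \<Rightarrow> nat option" where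
  "L_fun \<psi> A n = max_if_finite ((\<lambda>T. l_psi \<psi> T n) ` A)"

definition H_fun :: "(nat list \<Rightarrow> nat) \<Rightarrow> dtable set \<Rightarrow> nat \<Rightarrow> nat option" where
  "H_fun \<psi> A n = max_if_finite (psi_d \<psi> ` {T \<in> A. psi_a \<psi> T \<le> n})"

end

theory Submission
  imports Defs "HOL-Library.Countable"
begin

text \<open>If \<open>H\<close> is polynomially bounded, each of \<open>Z\<close>, \<open>G\<close>, \<open>L\<close> is bounded by choosing decisions that make
  a table easy nondeterministically and hard deterministically.  For \<open>L\<close>, every word of an irreducible
  cover needs its own leaf; for \<open>G\<close>, one searches for a deviation from an irreducible annihilating
  word; for \<open>Z\<close>, a complete table encodes the pigeonhole search problem, whose certificates have
  logarithmic length while its decision tree depth is almost linear in the number of columns.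

  Conversely, an irreducible cover that is extracted from an optimal nondeterministic tree for a table
  has at most \<open>L\<close> words.  The projection of the table to the attributes of these words has, by the
  Sauer--Shelah lemma, at most two to a polynomial many rows, and a halving strategy that
  queries annihilating words of length at most \<open>G\<close> or words of the cover solves it in polynomial depth.\<close>

text \<open>Since \<open>length u \<le> \<psi> u\<close>, and \<open>\<psi> u\<close> is at most
  \<open>length u\<close> times the largest weight of a letter, all strategies are measured in
  queries; weights enter only as a factor. The obstacle in the converse is that a table may have
  arbitrarily heavy attributes, while \<open>Z\<close> and \<open>G\<close> are controlled only
  where all weights are at most \<open>n\<close>. This is why the table is projected: letters of a
  cover word of weight at most \<open>n\<close> have weight at most \<open>n\<close> themselves. The
  cover may be exponentially large, but then the number of columns is still exponential in a
  polynomial, and so is its power with exponent \<open>Z\<close>. A collision of pigeons exists on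
  every row. It yields \<open>2 ^ b < H (2 * b * n)\<close> where the number of columns is below
  \<open>3 * (2 ^ b)\<^sup>2\<close>. The unknown \<open>b\<close> also occurs in the argument of
  \<open>H\<close>, but a fixed power of \<open>b\<close> is absorbed by the square root of
  \<open>2 ^ b\<close>.\<close>

definition agrees :: "(nat \<Rightarrow> nat) \<Rightarrow> word \<Rightarrow> bool" where
  "agrees r w \<longleftrightarrow> (\<forall>(i, d)\<in>set w. r i = d)"

lemma agrees_simps [simp]:
  "agrees r []"
  "agrees r (x # w) \<longleftrightarrow> r (fst x) = snd x \<and> agrees r w"
  "agrees r (u @ w) \<longleftrightarrow> agrees r u \<and> agrees r w"
  by (auto simp: agrees_def case_prod_beta ball_Un)

lemma sub_rows_agrees: "sub_rows T w = {r \<in> rows T. agrees r w}"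
  by (auto simp: sub_rows_def agrees_def)

lemma agrees_cong:
  assumes "\<And>i. i \<in> fst ` set w \<Longrightarrow> r i = s i"
  shows "agrees r w \<longleftrightarrow> agrees s w"
  using assms by (induction w) auto

lemma subseq_imp_set_subset: "subseq xs ys \<Longrightarrow> set xs \<subseteq> set ys"
  by (induction rule: list_emb.induct) auto

subsection \<open>Complexity measures\<close>

lemma bounded_cm_append_le: "bounded_cm \<psi> \<Longrightarrow> \<psi> (u @ v) \<le> \<psi> u + \<psi> v"
  unfolding bounded_cm_def partially_bounded_cm_def by blast

lemma bounded_cm_Nil [simp]: "bounded_cm \<psi> \<Longrightarrow> \<psi> [] = 0"
  unfolding bounded_cm_def partially_bounded_cm_def by blast

lemma bounded_cm_length: "bounded_cm \<psi> \<Longrightarrow> length u \<le> \<psi> u"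
  unfolding bounded_cm_def by blast

text \<open>Permutation invariance moves the letter to the front, and a prefix never weighs more
  than the word.\<close>

lemma bounded_cm_letter_le:
  assumes "bounded_cm \<psi>" "i \<in> set u"
  shows "\<psi> [i] \<le> \<psi> u"
proof -
  have "mset u = mset ([i] @ remove1 i u)" using assms(2) by simp
  then have "\<psi> u = \<psi> ([i] @ remove1 i u)"
    using assms(1) unfolding bounded_cm_def partially_bounded_cm_def by blast
  then show ?thesis
    using assms(1) unfolding bounded_cm_def partially_bounded_cm_def by metis
qed

lemma bounded_cm_le_length_mult:
  assumes "bounded_cm \<psi>" "\<And>i. i \<in> set u \<Longrightarrow> \<psi> [i] \<le> n"
  shows "\<psi> u \<le> length u * n"
  using assms(2)
proof (induction u)
  case Nil
  then show ?case using assms(1) by simp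
next
  case (Cons i u)
  have "\<psi> (i # u) \<le> \<psi> [i] + \<psi> u"
    using bounded_cm_append_le[OF assms(1), of "[i]" u] by simp
  moreover have "\<psi> [i] \<le> n" "\<psi> u \<le> length u * n" using Cons by auto
  ultimately show ?case by simp
qed

lemma m_psi_letter:
  assumes "finite (cols T)" "i \<in> cols T"
  shows "\<psi> [i] \<le> m_psi \<psi> T"
  using assms by (auto simp: m_psi_def)

lemma m_psi_le:
  assumes "finite (cols T)" "\<And>i. i \<in> cols T \<Longrightarrow> \<psi> [i] \<le> n"
  shows "m_psi \<psi> T \<le> n"
  using assms by (auto simp: m_psi_def)

subsection \<open>Decision trees\<close>

lemma paths_node_letters:
  assumes "wf_node c" "p \<in> set (paths_node c)" "x \<in> set (fst p)"
  shows "fst x \<in> attrs_node c \<and> snd x \<in> E2"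
  using assms
proof (induction c arbitrary: p)
  case (Leaf d)
  then show ?case by simp
next
  case (Node i cs)
  from Node.prems(2) obtain y q where y: "y \<in> set cs" "q \<in> set (paths_node (snd y))"
    and p: "p = ((i, fst y) # fst q, snd q)" by auto
  \<comment> \<open>The induction rule of \<open>dnode\<close> reaches the subtrees through the set
    function \<open>snds\<close> of pairs.\<close>
  have "snd y \<in> Basic_BNFs.snds y" by (auto simp: snds.simps prod_set_defs)
  with Node.IH[OF y(1) this _ y(2)] Node.prems y p show ?case by auto
qed

lemma paths_node_nonempty: "wf_node c \<Longrightarrow> paths_node c \<noteq> []"
proof (induction c)
  case (Node i cs)
  obtain y where y: "y \<in> set cs" using Node.prems by (cases cs) auto
  have "snd y \<in> Basic_BNFs.snds y" by (auto simp: prod_set_defs)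
  with Node.IH[OF y this] Node.prems y show ?case by auto
qed auto

lemma paths_tree_nonempty: "wf_tree \<Gamma> \<Longrightarrow> paths_tree \<Gamma> \<noteq> []"
  using paths_node_nonempty by (cases \<Gamma>) (auto simp: wf_tree_def paths_tree_def)

lemma paths_tree_Omega2:
  assumes "nondet_tree_for T \<Gamma>" "p \<in> set (paths_tree \<Gamma>)"
  shows "fst p \<in> Omega2 T"
proof -
  obtain c where c: "c \<in> set \<Gamma>" "p \<in> set (paths_node c)"
    using assms(2) by (auto simp: paths_tree_def)
  then have "wf_node c" "attrs_node c \<subseteq> cols T"
    using assms(1) by (auto simp: nondet_tree_for_def wf_tree_def attrs_tree_def)
  then show ?thesis
    using paths_node_letters[OF _ c(2)] by (fastforce simp: Omega2_def)
qed

lemma psi_tree_le_iff: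
  "wf_tree \<Gamma> \<Longrightarrow> psi_tree \<psi> \<Gamma> \<le> k \<longleftrightarrow> (\<forall>p\<in>set (paths_tree \<Gamma>). psi_w \<psi> (fst p) \<le> k)"
  using paths_tree_nonempty[of \<Gamma>] by (auto simp: psi_tree_def)

fun chain :: "word \<Rightarrow> nat \<Rightarrow> dnode" where
  "chain [] d = Leaf d"
| "chain (x # w) d = Node (fst x) [(snd x, chain w d)]"

lemma paths_chain: "paths_node (chain w d) = [(w, d)]"
  by (induction w) auto

lemma attrs_chain: "attrs_node (chain w d) = fst ` set w"
  by (induction w) auto

lemma wf_chain: "snd ` set w \<subseteq> E2 \<Longrightarrow> wf_node (chain w d)"
  by (induction w) auto

text \<open>A nondeterministic tree amounts to a set of certificates: words with decisions that
  jointly cover the rows. Hanging one chain per certificate at the root gives such a tree.\<close>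

lemma psi_a_le:
  assumes "finite P" "P \<noteq> {}"
    and letters: "\<And>w d. (w, d) \<in> P \<Longrightarrow> w \<in> Omega2 T"
    and cost: "\<And>w d. (w, d) \<in> P \<Longrightarrow> psi_w \<psi> w \<le> n"
    and cover: "\<And>r. r \<in> rows T \<Longrightarrow> \<exists>(w, d)\<in>P. agrees r w"
    and sound: "\<And>w d r. (w, d) \<in> P \<Longrightarrow> r \<in> rows T \<Longrightarrow> agrees r w \<Longrightarrow> d \<in> dec T r"
  shows "psi_a \<psi> T \<le> n"
proof -
  obtain xs where xs: "set xs = P" using assms(1) finite_list by blast
  define \<Gamma> where "\<Gamma> = map (\<lambda>x. chain (fst x) (snd x)) xs"
  have paths: "paths_tree \<Gamma> = xs"
    unfolding paths_tree_def \<Gamma>_def by (induction xs) (auto simp: paths_chain)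
  have wf: "wf_tree \<Gamma>"
    unfolding wf_tree_def \<Gamma>_def using xs assms(2) letters
    by (fastforce simp: Omega2_def intro!: wf_chain)
  have "attrs_tree \<Gamma> \<subseteq> cols T"
    unfolding attrs_tree_def \<Gamma>_def using xs letters
    by (fastforce simp: Omega2_def attrs_chain)
  moreover have "\<forall>r\<in>rows T. \<exists>p\<in>set (paths_tree \<Gamma>). r \<in> sub_rows T (fst p)"
    unfolding paths xs using cover by (force simp: sub_rows_agrees)
  moreover have "\<forall>p\<in>set (paths_tree \<Gamma>). sub_rows T (fst p) = {}
           \<or> snd p \<in> (\<Inter>r\<in>sub_rows T (fst p). dec T r)"
    using sound xs by (auto simp: paths sub_rows_agrees)
  ultimately have "nondet_tree_for T \<Gamma>"
    using wf by (simp add: nondet_tree_for_def)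
  then have "psi_a \<psi> T \<le> psi_tree \<psi> \<Gamma>"
    unfolding psi_a_def by (auto intro: Least_le)
  also have "\<dots> \<le> n"
    using cost xs wf by (auto simp: psi_tree_le_iff paths)
  finally show ?thesis .
qed

text \<open>Correctness is demanded only on the rows \<open>R\<close> still possible, so that
  strategies can be composed recursively; \<open>k\<close> counts queries instead of weight.\<close>

definition solves :: "dtable \<Rightarrow> (nat \<Rightarrow> nat) set \<Rightarrow> nat \<Rightarrow> dnode \<Rightarrow> bool" where
  "solves T R k c \<longleftrightarrow> wf_node c \<and> det_node c \<and> attrs_node c \<subseteq> cols T
     \<and> (\<forall>r\<in>R. \<exists>p\<in>set (paths_node c). agrees r (fst p))
     \<and> (\<forall>p\<in>set (paths_node c). length (fst p) \<le> k \<and>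
          (\<forall>r\<in>R. agrees r (fst p) \<longrightarrow> snd p \<in> dec T r))"

lemma solves_mono: "solves T R k c \<Longrightarrow> S \<subseteq> R \<Longrightarrow> k \<le> l \<Longrightarrow> solves T S l c"
  unfolding solves_def by (meson le_trans subsetD)

lemma solves_Leaf: "(\<And>r. r \<in> R \<Longrightarrow> d \<in> dec T r) \<Longrightarrow> solves T R k (Leaf d)"
  by (auto simp: solves_def)

lemma solves_Node:
  assumes "solves T {r \<in> R. r i = d} k c1" "solves T {r \<in> R. r i \<noteq> d} k c2"
    and "i \<in> cols T" "d \<in> E2" "\<And>r. r \<in> R \<Longrightarrow> r i \<in> E2"
  shows "solves T R (Suc k) (Node i [(d, c1), (1 - d, c2)])"
proof -
  have d: "d \<noteq> 1 - d" "1 - d \<in> E2" using assms(4) by (auto simp: E2_def)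
  have r: "r i = d \<or> r i = 1 - d" if "r \<in> R" for r
    using assms(4,5) that by (fastforce simp: E2_def)
  have "\<exists>p\<in>set (paths_node (Node i [(d, c1), (1 - d, c2)])). agrees r (fst p)" if "r \<in> R" for r
  proof (cases "r i = d")
    case True
    then obtain p where "p \<in> set (paths_node c1)" "agrees r (fst p)"
      using assms(1) \<open>r \<in> R\<close> by (auto simp: solves_def)
    then show ?thesis using True by (intro bexI[of _ "((i, d) # fst p, snd p)"]) auto
  next
    case False
    then obtain p where "p \<in> set (paths_node c2)" "agrees r (fst p)"
      using assms(2) \<open>r \<in> R\<close> by (auto simp: solves_def)
    then show ?thesis using False r[OF \<open>r \<in> R\<close>]
      by (intro bexI[of _ "((i, 1 - d) # fst p, snd p)"]) auto
  qed
  moreover have "length (fst p) \<le> Suc k \<and> (\<forall>r\<in>R. agrees r (fst p) \<longrightarrow> snd p \<in> dec T r)"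
    if "p \<in> set (paths_node (Node i [(d, c1), (1 - d, c2)]))" for p
  proof -
    from that consider q where "q \<in> set (paths_node c1)" "p = ((i, d) # fst q, snd q)"
      | q where "q \<in> set (paths_node c2)" "p = ((i, 1 - d) # fst q, snd q)" by auto
    then show ?thesis
    proof cases
      case 1
      then have "length (fst q) \<le> k"
        "\<And>r. r \<in> R \<Longrightarrow> r i = d \<Longrightarrow> agrees r (fst q) \<Longrightarrow> snd q \<in> dec T r"
        using assms(1) by (auto simp: solves_def)
      with 1 show ?thesis by (metis agrees_simps(2) fst_conv length_Cons not_less_eq_eq snd_conv)
    next
      case 2
      then have "length (fst q) \<le> k"
        "\<And>r. r \<in> R \<Longrightarrow> r i \<noteq> d \<Longrightarrow> agrees r (fst q) \<Longrightarrow> snd q \<in> dec T r"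
        using assms(2) by (auto simp: solves_def)
      with 2 d show ?thesis by (metis agrees_simps(2) fst_conv length_Cons not_less_eq_eq snd_conv)
    qed
  qed
  ultimately show ?thesis
    using assms(1-4) d unfolding solves_def by (simp del: paths_node.simps)
qed

text \<open>Query the letters of \<open>w\<close> in order. The first deviating answer hands over to
  the strategy for that deviation, and full agreement to the last one, so the costs add instead of
  multiplying.\<close>

lemma solves_word:
  assumes "set w \<subseteq> cols T \<times> E2" "\<And>r i. r \<in> R \<Longrightarrow> i \<in> cols T \<Longrightarrow> r i \<in> E2"
    and "\<And>i d. (i, d) \<in> set w \<Longrightarrow> \<exists>c. solves T {r \<in> R. r i \<noteq> d} k c"
    and "\<exists>c. solves T {r \<in> R. agrees r w} k c"
  shows "\<exists>c. solves T R (length w + k) c"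
  using assms
proof (induction w arbitrary: R)
  case Nil
  then show ?case by simp
next
  case (Cons x w)
  obtain i d where x: "x = (i, d)" by (cases x)
  have "\<exists>c. solves T {r \<in> R. r i = d} (length w + k) c"
  proof (rule Cons.IH)
    show "\<exists>c. solves T {r \<in> {r \<in> R. r i = d}. r j \<noteq> e} k c" if "(j, e) \<in> set w" for j e
    proof -
      have "(j, e) \<in> set (x # w)" using that by simp
      from Cons.prems(3)[OF this] obtain c where "solves T {r \<in> R. r j \<noteq> e} k c" ..
      then show ?thesis by (blast intro: solves_mono)
    qed
    show "\<exists>c. solves T {r \<in> {r \<in> R. r i = d}. agrees r w} k c"
      using Cons.prems(4) by (simp add: x conj_assoc)
  qed (use Cons.prems in auto)
  then obtain c1 where c1: "solves T {r \<in> R. r i = d} (length w + k) c1" ..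
  have "(i, d) \<in> set (x # w)" using x by simp
  from Cons.prems(3)[OF this] obtain c2 where "solves T {r \<in> R. r i \<noteq> d} k c2" ..
  then have c2: "solves T {r \<in> R. r i \<noteq> d} (length w + k) c2" by (rule solves_mono) auto
  show ?case
    using solves_Node[OF c1 c2] Cons.prems(1,2) x by fastforce
qed

lemma solves_imp_det_tree:
  assumes "solves T (rows T) k c"
  shows "det_tree_for T [c]"
  using assms
  by (auto simp: solves_def det_tree_for_def nondet_tree_for_def wf_tree_def attrs_tree_def
      paths_tree_def sub_rows_agrees)

lemma psi_d_le:
  assumes "bounded_cm \<psi>" "solves T (rows T) k c"
    and "\<And>i. i \<in> attrs_node c \<Longrightarrow> \<psi> [i] \<le> n"
  shows "psi_d \<psi> T \<le> k * n"
proof -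
  have det: "det_tree_for T [c]" using assms(2) by (rule solves_imp_det_tree)
  then have wf: "wf_tree [c]" by (simp add: det_tree_for_def nondet_tree_for_def)
  have "psi_d \<psi> T \<le> psi_tree \<psi> [c]"
    unfolding psi_d_def using det by (auto intro: Least_le)
  also have "\<dots> \<le> k * n"
  proof (unfold psi_tree_le_iff[OF wf], intro ballI)
    fix p assume "p \<in> set (paths_tree [c])"
    then have p: "p \<in> set (paths_node c)" by (simp add: paths_tree_def)
    have c: "wf_node c" "length (fst p) \<le> k" using p assms(2) by (auto simp: solves_def)
    have "\<psi> (map fst (fst p)) \<le> length (map fst (fst p)) * n"
      by (rule bounded_cm_le_length_mult[OF assms(1)])
        (use assms(3) paths_node_letters[OF c(1) p] in auto)
    also have "\<dots> \<le> k * n" using c(2) by simp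
    finally show "psi_w \<psi> (fst p) \<le> k * n" by (simp add: psi_w_def)
  qed
  finally show ?thesis .
qed

subsection \<open>The halving strategy\<close>

lemma is_table_E2: "is_table T \<Longrightarrow> r \<in> rows T \<Longrightarrow> i \<in> cols T \<Longrightarrow> r i \<in> E2"
  by (auto simp: is_table_def)

lemma annihilating_imp_irreducible:
  assumes "annihilating T w"
  obtains u where "subseq u w" "irreducible_ann T u"
  using assms
proof (induction "length w" arbitrary: w thesis rule: less_induct)
  case less
  show ?case
  proof (cases "irreducible_ann T w")
    case True
    then show ?thesis using less.prems(1)[of w] by simp
  next
    case False
    then obtain v where v: "subseq v w" "length v < length w" "annihilating T v"
      using less.prems(2) unfolding irreducible_ann_def by blast
    obtain u where "subseq u v" "irreducible_ann T u"
      using less.hyps[OF v(2) _ v(3)] by metis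
    then show ?thesis using less.prems(1) v(1) subseq_order.trans by blast
  qed
qed

text \<open>Each round queries a word on which the coordinatewise majority vector of the remaining rows
  is refuted or certified; every answer against the majority discards half of the rows.\<close>

lemma halving:
  assumes tab: "is_table T"
    and G: "\<And>w. irreducible_ann T w \<Longrightarrow> length w \<le> K"
    and P: "\<And>w d. (w, d) \<in> P \<Longrightarrow> w \<in> Omega2 T \<and> length w \<le> K"
    and cover: "\<And>r. r \<in> rows T \<Longrightarrow> \<exists>(w, d)\<in>P. agrees r w"
    and sound: "\<And>w d r. (w, d) \<in> P \<Longrightarrow> r \<in> rows T \<Longrightarrow> agrees r w \<Longrightarrow> d \<in> dec T r"
  shows "R \<subseteq> rows T \<Longrightarrow> card R < 2 ^ t \<Longrightarrow> \<exists>c. solves T R (t * K) c"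
proof (induction t arbitrary: R)
  case 0
  \<comment> \<open>The strict bound on \<open>card R\<close> leaves no row at \<open>t = 0\<close>,
    so any leaf is correct.\<close>
  then have "R = {}" using tab finite_subset by (fastforce simp: is_table_def)
  then show ?case using solves_Leaf[of R 0] by blast
next
  case (Suc t)
  have fin: "finite R" using Suc.prems(1) tab finite_subset by (auto simp: is_table_def)
  \<comment> \<open>The majority vector, with ties resolved to 0. It vanishes outside
    \<open>cols T\<close>, as every row does, so that it can itself be a row.\<close>
  define d where "d = (\<lambda>i. if i \<in> cols T then
      (if 2 * card {r \<in> R. r i \<noteq> 0} \<le> card R then 0 else 1) else 0 :: nat)"
  have dE2: "d i \<in> E2" for i by (simp add: d_def E2_def)
  have half: "\<exists>c. solves T {r \<in> R. r i \<noteq> d i} (t * K) c" if i: "i \<in> cols T" for i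
  proof (rule Suc.IH)
    have "2 * card {r \<in> R. r i \<noteq> d i} \<le> card R"
    proof (cases "2 * card {r \<in> R. r i \<noteq> 0} \<le> card R")
      case True
      then show ?thesis using i by (simp add: d_def)
    next
      case False
      have "{r \<in> R. r i \<noteq> 1} = {r \<in> R. r i = 0}"
        using is_table_E2[OF tab _ i] Suc.prems(1) by (auto simp: E2_def)
      moreover have "R = {r \<in> R. r i = 0} \<union> {r \<in> R. r i \<noteq> 0}" by auto
      then have "card R = card {r \<in> R. r i = 0} + card {r \<in> R. r i \<noteq> 0}"
        using fin by (metis (mono_tags, lifting) card_Un_disjnt disjnt_iff finite_Un mem_Collect_eq)
      ultimately show ?thesis using i False by (simp add: d_def)
    qed
    then show "card {r \<in> R. r i \<noteq> d i} < 2 ^ t" using Suc.prems(2) by simp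
  qed (use Suc.prems in auto)
  have "\<exists>w. set w \<subseteq> cols T \<times> E2 \<and> length w \<le> K \<and> agrees d w \<and>
            (\<exists>c. solves T {r \<in> R. agrees r w} (t * K) c)"
  proof (cases "d \<in> rows T")
    case True
    from cover[OF this] obtain w e where w: "(w, e) \<in> P" "agrees d w" by auto
    have "solves T {r \<in> R. agrees r w} (t * K) (Leaf e)"
      using sound[OF w(1)] Suc.prems(1) by (intro solves_Leaf) auto
    moreover have "set w \<subseteq> cols T \<times> E2" "length w \<le> K"
      using P[OF w(1)] by (auto simp: Omega2_def)
    ultimately show ?thesis using w(2) by (intro exI[of _ w]) auto
  next
    case False
    have "finite (cols T)" using tab by (simp add: is_table_def)
    then obtain xs where xs: "set xs = cols T" using finite_list by blast
    \<comment> \<open>Only the row \<open>d\<close> could agree with the word that spells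
      \<open>d\<close> out on all columns, so this word is annihilating; an irreducible subword
      refutes \<open>d\<close> within \<open>K\<close> queries.\<close>
    define u where "u = map (\<lambda>i. (i, d i)) xs"
    have "sub_rows T u = {}"
    proof (rule ccontr)
      assume "sub_rows T u \<noteq> {}"
      then obtain r where r: "r \<in> rows T" "agrees r u" by (auto simp: sub_rows_agrees)
      have "r i = d i" for i
      proof (cases "i \<in> cols T")
        case True
        then have "(i, d i) \<in> set u" using xs by (auto simp: u_def)
        then show ?thesis using r(2) by (auto simp: agrees_def)
      next
        case False
        then show ?thesis using tab r(1) by (auto simp: is_table_def d_def)
      qed
      then have "r = d" by auto
      then show False using r(1) \<open>d \<notin> rows T\<close> by simp
    qed
    then have "annihilating T u"
      using xs dE2 by (auto simp: annihilating_def Omega2_def u_def)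
    then obtain w where w: "subseq w u" "irreducible_ann T w"
      by (rule annihilating_imp_irreducible)
    have "set w \<subseteq> set u" using w(1) by (rule subseq_imp_set_subset)
    then have "agrees d w" by (auto simp: agrees_def u_def)
    moreover have "{r \<in> R. agrees r w} = {}"
      using w(2) Suc.prems(1) by (auto simp: irreducible_ann_def annihilating_def sub_rows_agrees)
    then have "\<exists>c. solves T {r \<in> R. agrees r w} (t * K) c"
      by (intro exI[of _ "Leaf 0"] solves_Leaf) auto
    moreover have "set w \<subseteq> cols T \<times> E2"
      using \<open>set w \<subseteq> set u\<close> xs dE2 by (auto simp: u_def)
    ultimately show ?thesis using G[OF w(2)] by (intro exI[of _ w]) auto
  qed
  then obtain w where w: "set w \<subseteq> cols T \<times> E2" "length w \<le> K" "agrees d w"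
      "\<exists>c. solves T {r \<in> R. agrees r w} (t * K) c" by blast
  \<comment> \<open>Because \<open>w\<close> follows \<open>d\<close>, the first answer against
    \<open>w\<close> is an answer against the majority, and the rows left are those of
    \<open>half\<close>.\<close>
  have "\<exists>c. solves T R (length w + t * K) c"
  proof (rule solves_word[OF w(1) _ _ w(4)])
    show "r i \<in> E2" if "r \<in> R" "i \<in> cols T" for r i
      using is_table_E2[OF tab] Suc.prems(1) that by auto
    show "\<exists>c. solves T {r \<in> R. r i \<noteq> e} (t * K) c" if "(i, e) \<in> set w" for i e
    proof -
      have "i \<in> cols T" "d i = e" using that w(1,3) by (auto simp: agrees_def)
      then show ?thesis using half[of i] by simp
    qed
  qed
  then obtain c where "solves T R (length w + t * K) c" ..
  then have "solves T R (Suc t * K) c" by (rule solves_mono) (use w(2) in auto)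
  then show ?case ..
qed

section \<open>Irreducible annihilating words and the parameter \<open>Gpar\<close>\<close>

lemma is_table_outside: "is_table T \<Longrightarrow> r \<in> rows T \<Longrightarrow> i \<notin> cols T \<Longrightarrow> r i = 0"
  by (auto simp: is_table_def)

lemma annihilating_cong: "set u = set w \<Longrightarrow> annihilating T u \<longleftrightarrow> annihilating T w"
  by (simp add: annihilating_def Omega2_def sub_rows_def)

text \<open>A second copy of a letter could be deleted, and an annihilating word never gives two
  values to one attribute.\<close>

lemma irreducible_ann_distinct:
  assumes "irreducible_ann T w"
  shows "distinct (map fst w)"
proof -
  have ann: "annihilating T w" using assms by (simp add: irreducible_ann_def)
  have "distinct w"
  proof (rule ccontr)
    assume "\<not> distinct w"
    then obtain xs ys zs y where w: "w = xs @ [y] @ ys @ [y] @ zs"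
      using not_distinct_decomp by blast
    let ?u = "xs @ [y] @ ys @ zs"
    have "subseq ?u w" unfolding w by (intro list_emb_append_mono) auto
    moreover have "annihilating T ?u"
      using ann by (subst annihilating_cong[of _ w]) (auto simp: w)
    ultimately show False using assms w unfolding irreducible_ann_def by fastforce
  qed
  moreover have "inj_on fst (set w)"
    using ann by (fastforce simp: inj_on_def annihilating_def)
  ultimately show ?thesis by (simp add: distinct_map)
qed

lemma irreducible_ann_cols: "irreducible_ann T w \<Longrightarrow> set w \<subseteq> cols T \<times> E2"
  by (auto simp: irreducible_ann_def annihilating_def Omega2_def)

lemma irreducible_ann_length:
  assumes "is_table T" "irreducible_ann T w"
  shows "length w \<le> card (cols T)"
proof -
  have "length w = card (fst ` set w)"
    using irreducible_ann_distinct[OF assms(2)] distinct_card by fastforce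
  also have "\<dots> \<le> card (cols T)"
    using assms(1) irreducible_ann_cols[OF assms(2)]
    by (intro card_mono) (auto simp: is_table_def)
  finally show ?thesis .
qed

lemma finite_irreducible_ann_lengths:
  "is_table T \<Longrightarrow> finite {length w | w. irreducible_ann T w}"
  by (rule finite_subset[of _ "{..card (cols T)}"]) (auto dest: irreducible_ann_length)

lemma Gpar_ge:
  assumes "is_table T" "rows T \<noteq> {}" "irreducible_ann T w"
  shows "length w \<le> Gpar T"
proof -
  have "length w \<in> {length w | w. irreducible_ann T w}" using assms(3) by blast
  from Max_ge[OF finite_irreducible_ann_lengths[OF assms(1)] this]
  show ?thesis using assms(2,3) by (auto simp: Gpar_def)
qed

lemma Gpar_le:
  assumes "is_table T" "\<And>w. rows T \<noteq> {} \<Longrightarrow> irreducible_ann T w \<Longrightarrow> length w \<le> b"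
  shows "Gpar T \<le> b"
proof (cases "rows T \<noteq> {} \<and> (\<exists>w. irreducible_ann T w)")
  case True
  then have "Max {length w | w. irreducible_ann T w} \<le> b"
    using assms(2) by (subst Max_le_iff[OF finite_irreducible_ann_lengths[OF assms(1)]]) auto
  then show ?thesis using True by (simp add: Gpar_def)
qed (auto simp: Gpar_def)

text \<open>A crude use of \<open>halving\<close> with entire rows as certificates. It provides the
  witness without which the \<open>LEAST\<close> in \<open>psi_a\<close> and \<open>psi_d\<close>
  would say nothing.\<close>

lemma ex_solves:
  assumes tab: "is_table T"
  shows "\<exists>k c. solves T (rows T) k c"
proof -
  have "finite (cols T)" using tab by (simp add: is_table_def)
  then obtain xs where xs: "set xs = cols T" "distinct xs" using finite_distinct_list by blast
  have len: "length xs = card (cols T)" using xs distinct_card by metis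
  define P where "P = {(map (\<lambda>i. (i, r i)) xs, d) | r d. r \<in> rows T \<and> d \<in> dec T r}"
  have "\<exists>c. solves T (rows T) (card (rows T) * card (cols T)) c"
  proof (rule halving[OF tab, of _ P])
    show "w \<in> Omega2 T \<and> length w \<le> card (cols T)" if "(w, d) \<in> P" for w d
      using that xs len is_table_E2[OF tab] by (auto simp: P_def Omega2_def)
    show "\<exists>(w, d)\<in>P. agrees r w" if r: "r \<in> rows T" for r
    proof -
      have "dec T r \<in> Pw" using tab r by (auto simp: is_table_def)
      then obtain d where "d \<in> dec T r" by (auto simp: Pw_def)
      then have "(map (\<lambda>i. (i, r i)) xs, d) \<in> P" using r by (auto simp: P_def)
      then show ?thesis by (rule bexI[rotated]) (auto simp: agrees_def)
    qed
    show "d \<in> dec T r" if P: "(w, d) \<in> P" and r: "r \<in> rows T" "agrees r w" for w d r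
    proof -
      obtain s where s: "s \<in> rows T" "d \<in> dec T s" "w = map (\<lambda>i. (i, s i)) xs"
        using P by (auto simp: P_def)
      have "r i = s i" for i
      proof (cases "i \<in> cols T")
        case True
        then show ?thesis using r(2) s(3) xs(1) by (auto simp: agrees_def)
      qed (simp add: is_table_outside[OF tab r(1)] is_table_outside[OF tab s(1)])
      then show ?thesis using s(2) by (metis ext)
    qed
  qed (use irreducible_ann_length[OF tab] in \<open>auto intro: less_exp\<close>)
  then show ?thesis by blast
qed

lemma psi_a_attained:
  assumes "is_table T" "rows T \<noteq> {}"
  obtains \<Gamma> where "nondet_tree_for T \<Gamma>" "psi_tree \<psi> \<Gamma> = psi_a \<psi> T"
proof -
  obtain k c where "solves T (rows T) k c" using ex_solves[OF assms(1)] by blast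
  then have "nondet_tree_for T [c]"
    using solves_imp_det_tree by (auto simp: det_tree_for_def)
  then have "\<exists>k \<Gamma>. nondet_tree_for T \<Gamma> \<and> psi_tree \<psi> \<Gamma> = k" by blast
  from LeastI_ex[OF this] show ?thesis using that assms(2) by (auto simp: psi_a_def)
qed

text \<open>For a bounded measure a path has no more letters than weight, so an optimal tree has
  depth at most \<open>psi_d\<close>. Lower bounds on the number of queries thereby become lower
  bounds on \<open>psi_d\<close>.\<close>

lemma psi_d_attained:
  assumes "bounded_cm \<psi>" "is_table T" "rows T \<noteq> {}"
  obtains c where "solves T (rows T) (psi_d \<psi> T) c"
proof -
  obtain k c where "solves T (rows T) k c" using ex_solves[OF assms(2)] by blast
  then have "\<exists>k \<Gamma>. det_tree_for T \<Gamma> \<and> psi_tree \<psi> \<Gamma> = k"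
    using solves_imp_det_tree by blast
  from LeastI_ex[OF this] obtain \<Gamma> where
    \<Gamma>: "det_tree_for T \<Gamma>" "psi_tree \<psi> \<Gamma> = psi_d \<psi> T"
    using assms(3) by (auto simp: psi_d_def)
  then obtain e where e: "\<Gamma> = [e]" by (auto simp: det_tree_for_def length_Suc_conv)
  have wf: "wf_tree \<Gamma>" using \<Gamma>(1) by (auto simp: det_tree_for_def nondet_tree_for_def)
  have "length (fst p) \<le> psi_d \<psi> T" if "p \<in> set (paths_node e)" for p
  proof -
    have "psi_w \<psi> (fst p) \<le> psi_d \<psi> T"
      using psi_tree_le_iff[OF wf, of \<psi> "psi_d \<psi> T"] \<Gamma>(2) that by (simp add: e paths_tree_def)
    then show ?thesis
      using bounded_cm_length[OF assms(1), of "map fst (fst p)"] by (simp add: psi_w_def)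
  qed
  then have "solves T (rows T) (psi_d \<psi> T) e"
    using \<Gamma>(1) unfolding e
    by (fastforce simp: solves_def det_tree_for_def nondet_tree_for_def wf_tree_def attrs_tree_def
        paths_tree_def sub_rows_agrees)
  then show ?thesis by (rule that)
qed

subsection \<open>Projections and closed classes\<close>

text \<open>The decision sets \<open>f\<close> are free: closed classes allow arbitrary relabelling,
  and each bound below poses its own problem through \<open>f\<close>.\<close>

definition restrict_tab :: "dtable \<Rightarrow> nat set \<Rightarrow> ((nat \<Rightarrow> nat) \<Rightarrow> nat set) \<Rightarrow> dtable" where
  "restrict_tab T B f = \<lparr>cols = B, rows = proj (cols T - B) ` rows T,
     dec = (\<lambda>r. if r \<in> proj (cols T - B) ` rows T then f r else {})\<rparr>"

lemma restrict_tab_simps [simp]: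
  "cols (restrict_tab T B f) = B"
  "rows (restrict_tab T B f) = proj (cols T - B) ` rows T"
  "r \<in> proj (cols T - B) ` rows T \<Longrightarrow> dec (restrict_tab T B f) r = f r"
  by (auto simp: restrict_tab_def)

lemma proj_apply_notin [simp]: "i \<notin> D \<Longrightarrow> proj D r i = r i"
  by (simp add: proj_def)

lemma agrees_proj: "fst ` set w \<subseteq> B \<Longrightarrow> agrees (proj (C - B) r) w \<longleftrightarrow> agrees r w"
  by (rule agrees_cong) auto

lemma proj_empty [simp]: "proj {} r = r"
  by (simp add: proj_def)

text \<open>\<open>B\<close> has to be nonempty because deleting all columns yields
  \<open>Lam\<close>, not a table with one row.\<close>

lemma restrict_tab_bracket:
  assumes "B \<subseteq> cols T" "B \<noteq> {}" "\<And>r. r \<in> proj (cols T - B) ` rows T \<Longrightarrow> f r \<in> Pw"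
  shows "restrict_tab T B f \<in> bracket T"
proof -
  have "cols T - (cols T - B) = B" "cols T - B \<noteq> cols T" using assms(1,2) by auto
  then show ?thesis
    unfolding bracket_def using assms(3)
    by (intro CollectI exI[of _ "cols T - B"]) (auto simp: restrict_tab_def)
qed

lemma bracket_closed: "closed_class A \<Longrightarrow> T \<in> A \<Longrightarrow> Q \<in> bracket T \<Longrightarrow> Q \<in> A"
  by (auto simp: closed_class_def bracket_class_def)

lemma Lam_in_closed:
  assumes "closed_class A"
  shows "Lam \<in> A"
proof -
  obtain T where T: "T \<in> A" using assms unfolding closed_class_def by blast
  have "Lam \<in> bracket T" by (auto simp: bracket_def)
  then show ?thesis by (rule bracket_closed[OF assms T])
qed

lemma closed_is_table: "closed_class A \<Longrightarrow> T \<in> A \<Longrightarrow> is_table T"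
  by (auto simp: closed_class_def)

lemma bracket_cols_subset: "Q \<in> bracket T \<Longrightarrow> cols Q \<subseteq> cols T"
  by (auto simp: bracket_def Lam_def)

lemma finite_complete_cols:
  assumes "is_table T"
  shows "finite {card (cols Q) | Q. Q \<in> bracket T \<and> complete_tab Q}"
proof (rule finite_subset)
  have "finite (cols T)" using assms by (simp add: is_table_def)
  then show "{card (cols Q) | Q. Q \<in> bracket T \<and> complete_tab Q} \<subseteq> {..card (cols T)}"
    by (auto dest!: bracket_cols_subset intro: card_mono)
qed simp

lemma Zpar_ge:
  assumes "is_table T" "rows T \<noteq> {}" "Q \<in> bracket T" "complete_tab Q"
  shows "card (cols Q) \<le> Zpar T"
proof -
  have "card (cols Q) \<in> {card (cols Q) | Q. Q \<in> bracket T \<and> complete_tab Q}"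
    using assms(3,4) by blast
  from Max_ge[OF finite_complete_cols[OF assms(1)] this]
  show ?thesis using assms(2-4) by (auto simp: Zpar_def)
qed

lemma Zpar_le:
  assumes "is_table T"
    and "\<And>Q. rows T \<noteq> {} \<Longrightarrow> Q \<in> bracket T \<Longrightarrow> complete_tab Q \<Longrightarrow> card (cols Q) \<le> b"
  shows "Zpar T \<le> b"
proof (cases "rows T \<noteq> {} \<and> (\<exists>Q\<in>bracket T. complete_tab Q)")
  case True
  then have "Max {card (cols Q) | Q. Q \<in> bracket T \<and> complete_tab Q} \<le> b"
    using assms(2) by (subst Max_le_iff[OF finite_complete_cols[OF assms(1)]]) auto
  then show ?thesis using True by (simp add: Zpar_def)
qed (auto simp: Zpar_def)

subsection \<open>The Sauer--Shelah bound\<close>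

definition shatters :: "'a set set \<Rightarrow> 'a set \<Rightarrow> bool" where
  "shatters F S \<longleftrightarrow> (\<forall>Y\<subseteq>S. \<exists>A\<in>F. A \<inter> S = Y)"

lemma shattersI: "(\<And>Y. Y \<subseteq> S \<Longrightarrow> \<exists>A\<in>F. A \<inter> S = Y) \<Longrightarrow> shatters F S"
  by (simp add: shatters_def)

lemma shattersD: "shatters F S \<Longrightarrow> Y \<subseteq> S \<Longrightarrow> \<exists>A\<in>F. A \<inter> S = Y"
  by (simp add: shatters_def)

lemma shatters_image: "shatters F S \<Longrightarrow> (\<lambda>A. A \<inter> S) ` F = Pow S"
proof (intro subset_antisym subsetI)
  fix Y assume "shatters F S" "Y \<in> Pow S"
  then obtain A where "A \<in> F" "A \<inter> S = Y" using shattersD[of F S Y] by auto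
  then show "Y \<in> (\<lambda>A. A \<inter> S) ` F" by auto
qed auto

text \<open>Pajor's form of the Sauer--Shelah lemma.\<close>

lemma card_le_card_shattered:
  assumes "finite X" "F \<subseteq> Pow X"
  shows "card F \<le> card {S. S \<subseteq> X \<and> shatters F S}"
  using assms
proof (induction X arbitrary: F rule: finite_induct)
  case empty
  then consider "F = {}" | "F = {{}}" by auto
  then show ?case
  proof cases
    case 2
    then have "{S. S \<subseteq> {} \<and> shatters F S} = {{}}" by (auto simp: shatters_def)
    then show ?thesis using 2 by simp
  qed simp
next
  case (insert x X)
  define F0 where "F0 = {A \<in> F. x \<notin> A}"
  define F1 where "F1 = (\<lambda>A. A - {x}) ` {A \<in> F. x \<in> A}"
  define S0 where "S0 = {S. S \<subseteq> X \<and> shatters F0 S}"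
  define S1 where "S1 = {S. S \<subseteq> X \<and> shatters F1 S}"
  have fin: "finite F" using insert finite_subset by blast
  have "F = F0 \<union> {A \<in> F. x \<in> A}" by (auto simp: F0_def)
  then have "card F \<le> card F0 + card {A \<in> F. x \<in> A}" by (metis card_Un_le)
  also have "card {A \<in> F. x \<in> A} = card F1"
    unfolding F1_def by (rule card_image[symmetric]) (auto simp: inj_on_def)
  also have "card F0 \<le> card S0"
    unfolding S0_def by (rule insert.IH) (use insert.prems in \<open>auto simp: F0_def\<close>)
  also have "card F1 \<le> card S1"
    unfolding S1_def by (rule insert.IH) (use insert.prems in \<open>auto simp: F1_def\<close>)
  \<comment> \<open>A set shattered by both halves is counted twice. The second count is charged to
    the set with \<open>x\<close> added, which \<open>F\<close> shatters: one half realises the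
    traces without \<open>x\<close>, the other those with \<open>x\<close>.\<close>
  also have "card S0 + card S1 = card (S0 \<union> S1) + card (S0 \<inter> S1)"
    using insert.hyps(1) by (intro card_Un_Int) (auto simp: S0_def S1_def)
  also have "card (S0 \<inter> S1) = card (insert x ` (S0 \<inter> S1))"
    using insert.hyps(2) by (intro card_image[symmetric]) (auto simp: inj_on_def S0_def)
  also have "card (S0 \<union> S1) + card (insert x ` (S0 \<inter> S1))
      = card ((S0 \<union> S1) \<union> insert x ` (S0 \<inter> S1))"
    using insert.hyps by (intro card_Un_disjoint[symmetric]) (auto simp: S0_def S1_def)
  also have "\<dots> \<le> card {S. S \<subseteq> insert x X \<and> shatters F S}"
  proof (rule card_mono)
    have "shatters F S" if "shatters F0 S" for S
      using shattersD[OF that] by (intro shattersI) (auto simp: F0_def)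
    moreover have "shatters F S" if S: "S \<subseteq> X" "shatters F1 S" for S
    proof (rule shattersI)
      fix Y assume "Y \<subseteq> S"
      then obtain A where "A \<in> F" "(A - {x}) \<inter> S = Y"
        using shattersD[OF S(2)] by (auto simp: F1_def)
      moreover have "x \<notin> S" using S(1) insert.hyps(2) by auto
      ultimately show "\<exists>A\<in>F. A \<inter> S = Y" by blast
    qed
    moreover have "shatters F (insert x S)"
      if S: "S \<subseteq> X" "shatters F0 S" "shatters F1 S" for S
    proof (rule shattersI)
      fix Y assume Y: "Y \<subseteq> insert x S"
      have x: "x \<notin> S" using S(1) insert.hyps(2) by auto
      show "\<exists>A\<in>F. A \<inter> insert x S = Y"
      proof (cases "x \<in> Y")
        case True
        have sub: "Y - {x} \<subseteq> S" using Y by auto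
        obtain A where "A \<in> F" "x \<in> A" "(A - {x}) \<inter> S = Y - {x}"
          using shattersD[OF S(3) sub] by (auto simp: F1_def)
        then show ?thesis using True x by (intro bexI[of _ A]) auto
      next
        case False
        then have "Y \<subseteq> S" using Y by auto
        from shattersD[OF S(2) this] obtain A where "A \<in> F0" "A \<inter> S = Y" by blast
        then show ?thesis using False by (intro bexI[of _ A]) (auto simp: F0_def)
      qed
    qed
    ultimately show "S0 \<union> S1 \<union> insert x ` (S0 \<inter> S1) \<subseteq> {S. S \<subseteq> insert x X \<and> shatters F S}"
      by (auto simp: S0_def S1_def)
  qed (use insert.hyps in auto)
  finally show ?case by simp
qed

text \<open>A set of at most \<open>z\<close> elements results from \<open>z\<close> choices, each
  adding one element of \<open>X\<close> or nothing.\<close>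

lemma card_subsets_le:
  assumes "finite X"
  shows "card {S. S \<subseteq> X \<and> card S \<le> z} \<le> (card X + 1) ^ z"
proof (induction z)
  case 0
  have "{S. S \<subseteq> X \<and> card S \<le> 0} = {{}}" using assms by (auto dest: finite_subset)
  then show ?case by simp
next
  case (Suc z)
  let ?F = "{S. S \<subseteq> X \<and> card S \<le> z}"
  have fin: "finite ?F" using assms by simp
  let ?g = "\<lambda>(y, S). case y of None \<Rightarrow> S | Some x \<Rightarrow> insert x S"
  let ?D = "insert None (Some ` X) \<times> ?F"
  have "{S. S \<subseteq> X \<and> card S \<le> Suc z} \<subseteq> ?g ` ?D"
  proof
    fix S assume S: "S \<in> {S. S \<subseteq> X \<and> card S \<le> Suc z}"
    show "S \<in> ?g ` ?D"
    proof (cases "card S \<le> z")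
      case True
      then show ?thesis using S by (intro image_eqI[of _ _ "(None, S)"]) auto
    next
      case False
      then obtain x where x: "x \<in> S" by (metis all_not_in_conv card.empty le0)
      have "card (S - {x}) \<le> z" using S x assms by (auto simp: card_Diff_singleton_if)
      then show ?thesis using S x by (intro image_eqI[of _ _ "(Some x, S - {x})"]) auto
    qed
  qed
  then have "card {S. S \<subseteq> X \<and> card S \<le> Suc z} \<le> card (?g ` ?D)"
    using assms fin by (intro card_mono) auto
  also have "\<dots> \<le> card ?D" using assms fin by (intro card_image_le) auto
  also have "\<dots> = (card X + 1) * card ?F"
    using assms by (simp add: card_cartesian_product card_image)
  also have "\<dots> \<le> (card X + 1) * (card X + 1) ^ z" by (rule mult_left_mono[OF Suc]) simp
  also have "\<dots> = (card X + 1) ^ Suc z" by simp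
  finally show ?case .
qed

text \<open>Turns the rows of a table into a set family, the setting of the shattering
  lemma.\<close>

definition ones :: "(nat \<Rightarrow> nat) \<Rightarrow> nat set" where
  "ones r = {i. r i = 1}"

lemma inj_on_ones:
  assumes "is_table T"
  shows "inj_on ones (rows T)"
proof (rule inj_onI)
  fix r s assume rs: "r \<in> rows T" "s \<in> rows T" "ones r = ones s"
  show "r = s"
  proof
    fix i
    have "r i \<in> {0, 1}" "s i \<in> {0, 1}"
      using assms rs by (cases "i \<in> cols T"; auto simp: is_table_def E2_def)+
    moreover have "r i = 1 \<longleftrightarrow> s i = 1" using rs(3) by (auto simp: ones_def)
    ultimately show "r i = s i" by auto
  qed
qed

lemma ones_subset: "is_table T \<Longrightarrow> r \<in> rows T \<Longrightarrow> ones r \<subseteq> cols T"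
  by (auto simp: is_table_def ones_def)

lemma ones_proj: "is_table T \<Longrightarrow> r \<in> rows T \<Longrightarrow> ones (proj (cols T - S) r) = ones r \<inter> S"
  using ones_subset[of T r] by (auto simp: ones_def proj_def split: if_splits)

lemma is_table_restrict:
  assumes "is_table T" "B \<subseteq> cols T" "B \<noteq> {}"
    and "\<And>r. r \<in> proj (cols T - B) ` rows T \<Longrightarrow> f r \<in> Pw"
  shows "is_table (restrict_tab T B f)"
proof -
  let ?Q = "restrict_tab T B f"
  have "finite B" using assms(1,2) by (auto simp: is_table_def intro: finite_subset)
  moreover have "finite (rows ?Q)" using assms(1) by (simp add: is_table_def)
  moreover have "rows T \<noteq> {}" using assms(1-3) by (auto simp: is_table_def)
  moreover have "r i \<in> E2" if "r \<in> rows ?Q" "i \<in> B" for r i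
    using that assms(2) is_table_E2[OF assms(1)] by auto
  moreover have "r i = 0" if "r \<in> rows ?Q" "i \<notin> B" for r i
    using that is_table_outside[OF assms(1)] by (auto simp: proj_def)
  ultimately show ?thesis
    using assms(3,4) by (auto simp: is_table_def restrict_tab_def)
qed

text \<open>Projecting to a shattered set of columns leaves every 0-1 row, hence a complete table in
  the bracket. The empty set is treated apart because no nonempty table has zero columns.\<close>

lemma shattered_le_Zpar:
  assumes tab: "is_table T" and S: "S \<subseteq> cols T" "shatters (ones ` rows T) S"
  shows "card S \<le> Zpar T"
proof (cases "S = {}")
  case False
  define Q where "Q = restrict_tab T S (\<lambda>_. {0})"
  have Q: "Q \<in> bracket T" "is_table Q"
    unfolding Q_def using tab S(1) False
    by (auto intro!: restrict_tab_bracket is_table_restrict simp: Pw_def)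
  have "ones ` rows Q = (\<lambda>A. A \<inter> S) ` ones ` rows T"
    using tab by (auto simp: Q_def image_image ones_proj)
  then have "card (ones ` rows Q) = 2 ^ card S"
    using S(1) shatters_image[OF S(2)] tab by (simp add: card_Pow is_table_def finite_subset)
  then have "card (rows Q) = 2 ^ card S"
    using card_image[OF inj_on_ones[OF Q(2)]] by simp
  then have "complete_tab Q" by (simp add: complete_tab_def Ntab_def Q_def)
  moreover have "rows T \<noteq> {}" using shattersD[OF S(2), of "{}"] by auto
  ultimately have "card (cols Q) \<le> Zpar T" using Q tab by (intro Zpar_ge)
  then show ?thesis by (simp add: Q_def)
qed simp

lemma card_rows_le:
  assumes tab: "is_table T"
  shows "card (rows T) \<le> (card (cols T) + 1) ^ Zpar T"
proof -
  have fin: "finite (cols T)" using tab by (simp add: is_table_def)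
  have "card (rows T) = card (ones ` rows T)"
    using card_image[OF inj_on_ones[OF tab]] by simp
  also have "\<dots> \<le> card {S. S \<subseteq> cols T \<and> shatters (ones ` rows T) S}"
    using ones_subset[OF tab] by (intro card_le_card_shattered fin) auto
  also have "\<dots> \<le> card {S. S \<subseteq> cols T \<and> card S \<le> Zpar T}"
    using fin shattered_le_Zpar[OF tab] by (intro card_mono) auto
  also have "\<dots> \<le> (card (cols T) + 1) ^ Zpar T" by (rule card_subsets_le[OF fin])
  finally show ?thesis .
qed

subsection \<open>Covers\<close>

text \<open>Words may repeat letters, so finiteness comes from the measure: weight at most
  \<open>n\<close> forces length at most \<open>n\<close>.\<close>

lemma finite_Omega2n:
  assumes "bounded_cm \<psi>" "is_table T"
  shows "finite (Omega2n \<psi> T n)"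
proof (rule finite_subset)
  show "Omega2n \<psi> T n \<subseteq> {w. set w \<subseteq> cols T \<times> E2 \<and> length w \<le> n}"
  proof
    fix w assume "w \<in> Omega2n \<psi> T n"
    then show "w \<in> {w. set w \<subseteq> cols T \<times> E2 \<and> length w \<le> n}"
      using bounded_cm_length[OF assms(1), of "map fst w"]
      by (auto simp: Omega2n_def Omega2_def psi_w_def)
  qed
  show "finite {w. set w \<subseteq> cols T \<times> E2 \<and> length w \<le> n}"
    using assms(2) by (intro finite_lists_length_le) (auto simp: is_table_def E2_def)
qed

lemma finite_irreducible_cover_cards:
  assumes "bounded_cm \<psi>" "is_table T"
  shows "finite {card U | U. irreducible_cover \<psi> T n U}"
  by (rule finite_subset[of _ "{..card (Omega2n \<psi> T n)}"])
    (auto simp: irreducible_cover_def is_cover_def intro: card_mono[OF finite_Omega2n[OF assms]])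

lemma cover_imp_irreducible:
  assumes "is_cover \<psi> T n U"
  obtains V where "V \<subseteq> U" "irreducible_cover \<psi> T n V"
  using assms
proof (induction "card U" arbitrary: U thesis rule: less_induct)
  case less
  show ?case
  proof (cases "irreducible_cover \<psi> T n U")
    case True
    then show ?thesis using less.prems(1)[of U] by simp
  next
    case False
    then obtain V where V: "V \<subset> U" "is_cover \<psi> T n V"
      using less.prems(2) unfolding irreducible_cover_def by blast
    have "card V < card U"
      using V(1) less.prems(2) by (intro psubset_card_mono) (auto simp: is_cover_def)
    from less.hyps[OF this _ V(2)] obtain W where "W \<subseteq> V" "irreducible_cover \<psi> T n W" by metis
    then show ?thesis using less.prems(1)[of W] V(1) by blast
  qed
qed

lemma l_psi_ge:
  assumes "bounded_cm \<psi>" "is_table T" "rows T \<noteq> {}" "irreducible_cover \<psi> T n U"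
  shows "card U \<le> l_psi \<psi> T n"
proof -
  have "card U \<in> {card U | U. irreducible_cover \<psi> T n U}" using assms(4) by blast
  from Max_ge[OF finite_irreducible_cover_cards[OF assms(1,2)] this]
  show ?thesis using assms(3) by (simp add: l_psi_def)
qed

lemma l_psi_le:
  assumes "bounded_cm \<psi>" "is_table T"
    and "\<And>U. rows T \<noteq> {} \<Longrightarrow> irreducible_cover \<psi> T n U \<Longrightarrow> card U \<le> b"
  shows "l_psi \<psi> T n \<le> b"
proof (cases "rows T = {}")
  case False
  \<comment> \<open>The empty word covers all rows, so an irreducible cover exists and the
    \<open>Max\<close> in \<open>l_psi\<close> ranges over a nonempty set.\<close>
  have "is_cover \<psi> T n {[]}"
    using assms(1) by (auto simp: is_cover_def Omega2n_def Omega2_def psi_w_def sub_rows_agrees)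
  then obtain V where "irreducible_cover \<psi> T n V" by (rule cover_imp_irreducible)
  then have "{card U | U. irreducible_cover \<psi> T n U} \<noteq> {}" by blast
  then show ?thesis
    using False assms(3) finite_irreducible_cover_cards[OF assms(1,2), of n]
    by (auto simp: l_psi_def)
qed (simp add: l_psi_def)

subsection \<open>The upper bound\<close>

text \<open>The projected table has at most \<open>2 ^ q * n\<close> columns and so at most
  \<open>(2 ^ (n + q)) ^ z\<close> rows; the first factor of the bound is the number of halving
  rounds. A round costs at most \<open>g + n\<close> queries, \<open>g\<close> for a refuting word
  or \<open>n\<close> for a cover word, and a query weighs at most \<open>n\<close>.\<close>

lemma psi_d_upper:
  assumes A: "closed_class A" and \<psi>: "bounded_cm \<psi>"
    and T: "T \<in> A" "rows T \<noteq> {}" "psi_a \<psi> T \<le> n"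
    and Z: "\<And>Q. Q \<in> A \<Longrightarrow> m_psi \<psi> Q \<le> n \<Longrightarrow> Zpar Q \<le> z"
    and G: "\<And>Q. Q \<in> A \<Longrightarrow> m_psi \<psi> Q \<le> n \<Longrightarrow> Gpar Q \<le> g"
    and L: "l_psi \<psi> T n \<le> 2 ^ q"
  shows "psi_d \<psi> T \<le> (((n + q) * z + 1) * (g + n)) * n"
proof -
  have tab: "is_table T" using A T(1) by (rule closed_is_table)
  obtain \<Gamma> where \<Gamma>: "nondet_tree_for T \<Gamma>" "psi_tree \<psi> \<Gamma> = psi_a \<psi> T"
    using psi_a_attained[OF tab T(2)] .
  have wf: "wf_tree \<Gamma>" using \<Gamma>(1) by (simp add: nondet_tree_for_def)
  define W where "W = fst ` set (paths_tree \<Gamma>)"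
  have "W \<subseteq> Omega2n \<psi> T n"
    using paths_tree_Omega2[OF \<Gamma>(1)] psi_tree_le_iff[OF wf, of \<psi> n] \<Gamma>(2) T(3)
    by (auto simp: W_def Omega2n_def)
  moreover have "(\<Union>w\<in>W. sub_rows T w) = rows T"
    using \<Gamma>(1) by (fastforce simp: W_def nondet_tree_for_def sub_rows_agrees)
  ultimately have "is_cover \<psi> T n W" by (auto simp: is_cover_def W_def)
  then obtain U where U: "U \<subseteq> W" "irreducible_cover \<psi> T n U" by (rule cover_imp_irreducible)
  have Ucov: "finite U" "U \<subseteq> Omega2n \<psi> T n" "(\<Union>w\<in>U. sub_rows T w) = rows T"
    using U(2) by (auto simp: irreducible_cover_def is_cover_def)
  have cardU: "card U \<le> 2 ^ q"
    using l_psi_ge[OF \<psi> tab T(2) U(2)] L by simp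
  have "\<forall>w\<in>U. \<exists>d. \<forall>r\<in>rows T. agrees r w \<longrightarrow> d \<in> dec T r"
  proof
    fix w assume "w \<in> U"
    then obtain p where p: "p \<in> set (paths_tree \<Gamma>)" "fst p = w" using U(1) by (auto simp: W_def)
    then show "\<exists>d. \<forall>r\<in>rows T. agrees r w \<longrightarrow> d \<in> dec T r"
      using \<Gamma>(1) by (intro exI[of _ "snd p"]) (auto simp: nondet_tree_for_def sub_rows_agrees)
  qed
  then obtain e where e: "\<And>w r. w \<in> U \<Longrightarrow> r \<in> rows T \<Longrightarrow> agrees r w \<Longrightarrow> e w \<in> dec T r"
    by metis
  have cover: "\<exists>w\<in>U. agrees r w" if "r \<in> rows T" for r
    using Ucov(3) that by (auto simp: sub_rows_agrees)
  have len: "length w \<le> n" if "w \<in> U" for w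
    using that Ucov(2) bounded_cm_length[OF \<psi>, of "map fst w"]
    by (auto simp: Omega2n_def psi_w_def)
  define B where "B = (\<Union>w\<in>U. fst ` set w)"
  have B: "B \<subseteq> cols T" using Ucov(2) by (fastforce simp: B_def Omega2n_def Omega2_def)
  have letter: "\<psi> [i] \<le> n" if i: "i \<in> B" for i
  proof -
    obtain w where w: "w \<in> U" "i \<in> set (map fst w)" using i by (auto simp: B_def)
    have "\<psi> [i] \<le> \<psi> (map fst w)" by (rule bounded_cm_letter_le[OF \<psi> w(2)])
    also have "\<dots> \<le> n" using w(1) Ucov(2) by (auto simp: Omega2n_def psi_w_def)
    finally show ?thesis .
  qed
  have "card B \<le> (\<Sum>w\<in>U. card (fst ` set w))"
    unfolding B_def by (rule card_UN_le[OF Ucov(1)])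
  also have "\<dots> \<le> (\<Sum>w\<in>U. n)"
  proof (rule sum_mono)
    fix w assume "w \<in> U"
    have "card (fst ` set w) \<le> length w"
      using card_length[of "map fst w"] by simp
    then show "card (fst ` set w) \<le> n" using len[OF \<open>w \<in> U\<close>] by simp
  qed
  also have "\<dots> = card U * n" by simp
  also have "\<dots> \<le> 2 ^ q * n" by (rule mult_right_mono[OF cardU]) simp
  finally have cardB: "card B \<le> 2 ^ q * n" .
  show ?thesis
  proof (cases "B = {}")
    case True
    \<comment> \<open>Without attributes the cover contains only the empty word, and a single leaf
      suffices. Projecting is impossible here, since it would give \<open>Lam\<close>.\<close>
    obtain r where r: "r \<in> rows T" using T(2) by blast
    obtain w where w: "w \<in> U" using cover[OF r] by blast
    have "w = []" using True w by (auto simp: B_def)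
    then have c: "solves T (rows T) 0 (Leaf (e w))" using e[OF w] by (intro solves_Leaf) auto
    have "psi_d \<psi> T \<le> 0 * n" by (rule psi_d_le[OF \<psi> c]) auto
    then show ?thesis by simp
  next
    case False
    \<comment> \<open>With these decisions the cover words certify the projected table too, and each
      decision of a projected row is correct for all rows of \<open>T\<close> above it.\<close>
    define f where "f = (\<lambda>r. e ` {w \<in> U. agrees r w})"
    define Q where "Q = restrict_tab T B f"
    have UB: "fst ` set w \<subseteq> B" if "w \<in> U" for w using that by (auto simp: B_def)
    have f: "f r \<in> Pw" if r: "r \<in> proj (cols T - B) ` rows T" for r
    proof -
      obtain s where s: "s \<in> rows T" "r = proj (cols T - B) s" using r by blast
      obtain w where "w \<in> U" "agrees s w" using cover[OF s(1)] by blast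
      then show ?thesis using s(2) Ucov(1) agrees_proj[OF UB] by (auto simp: f_def Pw_def)
    qed
    have QA: "Q \<in> A"
      unfolding Q_def by (rule bracket_closed[OF A T(1) restrict_tab_bracket[OF B False f]])
    have Qtab: "is_table Q" using A QA by (rule closed_is_table)
    have Qrows: "rows Q \<noteq> {}" using T(2) by (simp add: Q_def)
    have finB: "finite B" using Qtab by (simp add: is_table_def Q_def)
    have mQ: "m_psi \<psi> Q \<le> n" by (rule m_psi_le) (use finB letter in \<open>auto simp: Q_def\<close>)
    have "card (rows Q) \<le> (card B + 1) ^ Zpar Q"
      using card_rows_le[OF Qtab] by (simp add: Q_def)
    also have "\<dots> \<le> (card B + 1) ^ z" using Z[OF QA mQ] by (intro power_increasing) auto
    also have "\<dots> \<le> (2 ^ (n + q)) ^ z"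
    proof (rule power_mono)
      have "card B + 1 \<le> 2 ^ q * (n + 1)" using add_mono[OF cardB, of 1 "2 ^ q"] by (simp add: add.commute)
      also have "\<dots> \<le> 2 ^ q * 2 ^ n" by (intro mult_left_mono) (simp_all add: Suc_le_eq)
      finally show "card B + 1 \<le> 2 ^ (n + q)" by (simp add: power_add mult.commute)
    qed simp
    also have "\<dots> < 2 ^ ((n + q) * z + 1)" by (simp add: power_mult)
    finally have cardQ: "card (rows Q) < 2 ^ ((n + q) * z + 1)" .
    have "\<exists>c. solves Q (rows Q) (((n + q) * z + 1) * (g + n)) c"
    proof (rule halving[OF Qtab, where P = "(\<lambda>w. (w, e w)) ` U"])
      show "length w \<le> g + n" if "irreducible_ann Q w" for w
        using Gpar_ge[OF Qtab Qrows that] G[OF QA mQ] by simp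
      show "w \<in> Omega2 Q \<and> length w \<le> g + n" if "(w, d) \<in> (\<lambda>w. (w, e w)) ` U" for w d
      proof -
        have w: "w \<in> U" using that by auto
        have "w \<in> Omega2 T" using w Ucov(2) by (auto simp: Omega2n_def)
        then have "w \<in> Omega2 Q" using UB[OF w] by (force simp: Omega2_def Q_def)
        then show ?thesis using len[OF w] by simp
      qed
      show "\<exists>(w, d)\<in>(\<lambda>w. (w, e w)) ` U. agrees r w" if r: "r \<in> rows Q" for r
      proof -
        obtain s where s: "s \<in> rows T" "r = proj (cols T - B) s" using r by (auto simp: Q_def)
        obtain w where w: "w \<in> U" "agrees s w" using cover[OF s(1)] by blast
        then have "agrees r w" using agrees_proj[OF UB] s(2) by simp
        then show ?thesis using w(1) by blast
      qed
      show "d \<in> dec Q r" if "(w, d) \<in> (\<lambda>w. (w, e w)) ` U" "r \<in> rows Q" "agrees r w" for w d r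
        using that by (auto simp: Q_def f_def)
    qed (use cardQ in auto)
    then obtain c where c: "solves Q (rows Q) (((n + q) * z + 1) * (g + n)) c" ..
    have attrs: "attrs_node c \<subseteq> B" using c by (simp add: solves_def Q_def)
    \<comment> \<open>The tree queries only attributes in \<open>B\<close>, where a row and its
      projection coincide; hence it can be run on \<open>T\<close>.\<close>
    have ag: "agrees (proj (cols T - B) r) (fst p) \<longleftrightarrow> agrees r (fst p)"
      if "p \<in> set (paths_node c)" for p r
    proof (rule agrees_proj)
      show "fst ` set (fst p) \<subseteq> B"
      proof -
        have "wf_node c" using c by (simp add: solves_def)
        then show ?thesis using paths_node_letters[OF _ that] attrs by blast
      qed
    qed
    have dec: "d \<in> dec T r" if r: "r \<in> rows T" and d: "d \<in> f (proj (cols T - B) r)" for d r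
      using d r e agrees_proj[OF UB] by (auto simp: f_def)
    have "solves T (rows T) (((n + q) * z + 1) * (g + n)) c"
      unfolding solves_def
    proof (intro conjI ballI impI)
      show "attrs_node c \<subseteq> cols T" using attrs B by blast
      show "\<exists>p\<in>set (paths_node c). agrees r (fst p)" if "r \<in> rows T" for r
        using c that ag by (auto simp: solves_def Q_def)
      show "snd p \<in> dec T r"
        if p: "p \<in> set (paths_node c)" "r \<in> rows T" "agrees r (fst p)" for p r
      proof (rule dec[OF p(2)])
        have "agrees (proj (cols T - B) r) (fst p)" using ag p(1,3) by simp
        then show "snd p \<in> f (proj (cols T - B) r)"
          using c p(1,2) by (simp add: solves_def Q_def)
      qed
    qed (use c in \<open>auto simp: solves_def\<close>)
    then show ?thesis by (rule psi_d_le[OF \<psi>]) (use letter attrs in auto)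
  qed
qed

subsection \<open>Lower bounds by adversaries\<close>

lemma paths_node_Node:
  assumes "y \<in> set cs" "q \<in> set (paths_node (snd y))"
  shows "((i, fst y) # fst q, snd q) \<in> set (paths_node (Node i cs))"
  using imageI[OF assms(2), of "\<lambda>p. ((i, fst y) # fst p, snd p)"] assms(1) by auto

text \<open>The adversary maintains a set of attributes whose values are promised; \<open>Inv k S x\<close> means that it
  survives \<open>k\<close> further queries after promising the values of \<open>x\<close> on \<open>S\<close>.\<close>

lemma adversary:
  assumes "wf_node c" "det_node c" "attrs_node c \<subseteq> C"
    and "\<And>p. p \<in> set (paths_node c) \<Longrightarrow> length (fst p) \<le> k" and "Inv k S x"
    and step: "\<And>k S x i. Inv (Suc k) S x \<Longrightarrow> i \<in> C \<Longrightarrow>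
      \<exists>S' x'. Inv k S' x' \<and> S \<subseteq> S' \<and> i \<in> S' \<and> (\<forall>j\<in>S. x' j = x j)"
  shows "\<exists>k' S' x'. Inv k' S' x' \<and> S \<subseteq> S' \<and> (\<forall>j\<in>S. x' j = x j) \<and>
    (\<forall>p\<in>set (paths_node c). \<forall>r. (\<forall>j\<in>S'. r j = x' j) \<longrightarrow> agrees r (fst p) \<longrightarrow>
       fst ` set (fst p) \<subseteq> S')"
  using assms(1-5)
proof (induction c arbitrary: k S x)
  case (Leaf d)
  then show ?case by (intro exI[of _ k] exI[of _ S] exI[of _ x]) simp
next
  case (Node i cs)
  \<comment> \<open>A path through a query has a letter, so the budget \<open>k\<close> is
    positive.\<close>
  obtain p where p: "p \<in> set (paths_node (Node i cs))"
    using paths_node_nonempty[OF Node.prems(1)] by (meson list.set_sel(1))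
  then have "length (fst p) \<noteq> 0" by auto
  then obtain k0 where k: "k = Suc k0" using Node.prems(4)[OF p] by (cases k) auto
  have i: "i \<in> C" using Node.prems(3) by simp
  obtain S1 x1 where 1: "Inv k0 S1 x1" "S \<subseteq> S1" "i \<in> S1" "\<forall>j\<in>S. x1 j = x j"
    using step[OF Node.prems(5)[unfolded k] i] by blast
  show ?case
  proof (cases "\<exists>y\<in>set cs. fst y = x1 i")
    case False
    \<comment> \<open>No edge carries the promised answer, so a row with the promised values follows
      no path and the claim is vacuous.\<close>
    have "\<not> agrees r (fst p)"
      if "p \<in> set (paths_node (Node i cs))" "\<forall>j\<in>S1. r j = x1 j" for p r
      using that False 1(3) by auto
    then show ?thesis using 1 by (intro exI[of _ k0] exI[of _ S1] exI[of _ x1]) blast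
  next
    case True
    then obtain y where y: "y \<in> set cs" "fst y = x1 i" by blast
    have snds: "snd y \<in> Basic_BNFs.snds y" by (auto simp: prod_set_defs)
    have len: "length (fst q) \<le> k0" if "q \<in> set (paths_node (snd y))" for q
    proof -
      have "((i, fst y) # fst q, snd q) \<in> set (paths_node (Node i cs))"
        using y(1) that by (rule paths_node_Node)
      from Node.prems(4)[OF this] show ?thesis by (simp add: k)
    qed
    have "\<exists>k' S' x'. Inv k' S' x' \<and> S1 \<subseteq> S' \<and> (\<forall>j\<in>S1. x' j = x1 j) \<and>
      (\<forall>p\<in>set (paths_node (snd y)). \<forall>r. (\<forall>j\<in>S'. r j = x' j) \<longrightarrow> agrees r (fst p) \<longrightarrow>
         fst ` set (fst p) \<subseteq> S')"
      by (rule Node.IH[OF y(1) snds _ _ _ len 1(1)]) (use Node.prems(1-3) y(1) in auto)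
    then obtain k' S' x' where 2: "Inv k' S' x'" "S1 \<subseteq> S'" "\<forall>j\<in>S1. x' j = x1 j"
      and paths: "\<forall>p\<in>set (paths_node (snd y)). \<forall>r. (\<forall>j\<in>S'. r j = x' j) \<longrightarrow>
        agrees r (fst p) \<longrightarrow> fst ` set (fst p) \<subseteq> S'"
      by (elim exE conjE) (rule that)
    have "fst ` set (fst p) \<subseteq> S'"
      if p: "p \<in> set (paths_node (Node i cs))" "\<forall>j\<in>S'. r j = x' j" "agrees r (fst p)" for p r
    proof -
      obtain z q where z: "z \<in> set cs" "q \<in> set (paths_node (snd z))"
        "p = ((i, fst z) # fst q, snd q)" using p(1) by auto
      have iS: "i \<in> S'" using 1(3) 2(2) by blast
      have "r i = x1 i" using p(2) iS 1(3) 2(3) by auto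
      moreover have "r i = fst z" using p(3) z(3) by simp
      ultimately have "fst z = fst y" using y(2) by simp
      \<comment> \<open>Determinism: a row with the promised values can leave the node only along
        \<open>y\<close>.\<close>
      moreover have "distinct (map fst cs)" using Node.prems(2) by simp
      ultimately have "z = y" using y(1) z(1) by (metis eq_key_imp_eq_value prod.collapse)
      then have "fst ` set (fst q) \<subseteq> S'" using paths z(2,3) p(2,3) by simp
      then show ?thesis using z(3) iS by simp
    qed
    moreover have "\<forall>j\<in>S. x' j = x j" using 1(2,4) 2(3) by (metis subsetD)
    ultimately show ?thesis using 2(1) subset_trans[OF 1(2) 2(2)]
      by (intro exI[of _ k'] exI[of _ S'] exI[of _ x']) simp
  qed
qed

subsection \<open>Covers need many leaves\<close>

lemma length_paths_node:
  assumes "wf_node c" "det_node c" "\<And>p. p \<in> set (paths_node c) \<Longrightarrow> length (fst p) \<le> k"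
  shows "length (paths_node c) \<le> 2 ^ k"
  using assms
proof (induction c arbitrary: k)
  case (Leaf d)
  then show ?case by simp
next
  case (Node i cs)
  obtain p where p: "p \<in> set (paths_node (Node i cs))"
    using paths_node_nonempty[OF Node.prems(1)] by (meson list.set_sel(1))
  then have "length (fst p) \<noteq> 0" by auto
  then obtain k0 where k: "k = Suc k0" using Node.prems(3)[OF p] by (cases k) auto
  have IH: "length (paths_node (snd y)) \<le> 2 ^ k0" if y: "y \<in> set cs" for y
  proof (rule Node.IH[OF y])
    show "snd y \<in> Basic_BNFs.snds y" by (auto simp: prod_set_defs)
    show "length (fst q) \<le> k0" if "q \<in> set (paths_node (snd y))" for q
    proof -
      have "((i, fst y) # fst q, snd q) \<in> set (paths_node (Node i cs))"
        using y that by (rule paths_node_Node)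
      from Node.prems(3)[OF this] show ?thesis by (simp add: k)
    qed
  qed (use Node.prems y in auto)
  have "length cs = card (fst ` set cs)" using Node.prems(2) distinct_card by fastforce
  also have "\<dots> \<le> card E2" using Node.prems(1) by (intro card_mono) (auto simp: E2_def)
  finally have two: "length cs \<le> 2" by (simp add: E2_def)
  have "length (paths_node (Node i cs)) = (\<Sum>y\<leftarrow>cs. length (paths_node (snd y)))"
    by (simp add: length_concat comp_def)
  also have "\<dots> \<le> (\<Sum>y\<leftarrow>cs. 2 ^ k0)" by (rule sum_list_mono) (rule IH)
  also have "\<dots> = length cs * 2 ^ k0" by (simp add: sum_list_triv)
  also have "\<dots> \<le> 2 * 2 ^ k0" by (rule mult_right_mono[OF two]) simp
  finally show ?case by (simp add: k)
qed

text \<open>By irreducibility each word has a private row, covered by no other word of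
  \<open>U\<close>. If the decisions of a row are the codes of the words it satisfies, a private row
  admits only its own word. A binary tree of depth \<open>h\<close> has at most \<open>2 ^ h\<close>
  leaves.\<close>

lemma irreducible_cover_card_le:
  assumes A: "closed_class A" and \<psi>: "bounded_cm \<psi>" and T: "T \<in> A" "rows T \<noteq> {}"
    and U: "irreducible_cover \<psi> T n U"
    and H: "\<And>Q. Q \<in> A \<Longrightarrow> psi_a \<psi> Q \<le> n \<Longrightarrow> psi_d \<psi> Q \<le> h"
  shows "card U \<le> 2 ^ h"
proof -
  have tab: "is_table T" using A T(1) by (rule closed_is_table)
  have Ucov: "finite U" "U \<subseteq> Omega2n \<psi> T n" "(\<Union>w\<in>U. sub_rows T w) = rows T"
    using U by (auto simp: irreducible_cover_def is_cover_def)
  have colsne: "cols T \<noteq> {}" using tab T(2) by (auto simp: is_table_def)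
  have cover: "\<exists>w\<in>U. agrees r w" if "r \<in> rows T" for r
    using Ucov(3) that by (auto simp: sub_rows_agrees)
  define f where "f = (\<lambda>r. to_nat ` {w \<in> U. agrees r w})"
  define Q where "Q = restrict_tab T (cols T) f"
  have Qsimps: "cols Q = cols T" "rows Q = rows T" "\<And>r. r \<in> rows T \<Longrightarrow> dec Q r = f r"
    by (auto simp: Q_def)
  have fPw: "f r \<in> Pw" if "r \<in> proj (cols T - cols T) ` rows T" for r
    using that cover Ucov(1) by (auto simp: f_def Pw_def)
  have QA: "Q \<in> A"
    unfolding Q_def
    by (rule bracket_closed[OF A T(1) restrict_tab_bracket]) (use colsne fPw in auto)
  have "U \<noteq> {}" using T(2) cover by blast
  have "psi_a \<psi> Q \<le> n"
  proof (rule psi_a_le[where P = "(\<lambda>w. (w, to_nat w)) ` U"])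
    show "\<exists>(w, d)\<in>(\<lambda>w. (w, to_nat w)) ` U. agrees r w" if "r \<in> rows Q" for r
    proof -
      obtain w where "w \<in> U" "agrees r w" using cover \<open>r \<in> rows Q\<close> by (auto simp: Qsimps)
      then show ?thesis by blast
    qed
    show "w \<in> Omega2 Q" "psi_w \<psi> w \<le> n" if "(w, d) \<in> (\<lambda>w. (w, to_nat w)) ` U" for w d
      using that Ucov(2) by (auto simp: Omega2n_def Omega2_def Qsimps)
    show "d \<in> dec Q r" if "(w, d) \<in> (\<lambda>w. (w, to_nat w)) ` U" "r \<in> rows Q" "agrees r w" for w d r
      using that by (auto simp: Qsimps f_def)
  qed (use Ucov(1) \<open>U \<noteq> {}\<close> in auto)
  then have h: "psi_d \<psi> Q \<le> h" by (rule H[OF QA])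
  have "rows Q \<noteq> {}" using T(2) by (simp add: Qsimps)
  then obtain c where "solves Q (rows Q) (psi_d \<psi> Q) c"
    using psi_d_attained[OF \<psi> closed_is_table[OF A QA]] by blast
  then have c: "solves Q (rows Q) h c" by (rule solves_mono) (use h in auto)
  have "to_nat ` U \<subseteq> snd ` set (paths_node c)"
  proof
    fix d assume "d \<in> to_nat ` U"
    then obtain w where w: "w \<in> U" "d = to_nat w" by blast
    have "\<not> is_cover \<psi> T n (U - {w})"
    proof -
      have "U - {w} \<subset> U" using w(1) by blast
      then show ?thesis using U unfolding irreducible_cover_def by blast
    qed
    then have "(\<Union>v\<in>U - {w}. sub_rows T v) \<noteq> rows T"
      using Ucov(1,2) by (auto simp: is_cover_def)
    then obtain r where r: "r \<in> rows T" "\<And>v. v \<in> U \<Longrightarrow> v \<noteq> w \<Longrightarrow> \<not> agrees r v"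
      by (auto simp: sub_rows_agrees)
    then obtain p where p: "p \<in> set (paths_node c)" "snd p \<in> dec Q r"
      using c unfolding solves_def Qsimps by blast
    have "dec Q r \<subseteq> {d}" using r w(2) by (auto simp: Qsimps f_def)
    then have "snd p = d" using p(2) by blast
    then show "d \<in> snd ` set (paths_node c)" using p(1) by force
  qed
  then have "card (to_nat ` U) \<le> card (snd ` set (paths_node c))" by (intro card_mono) auto
  also have "\<dots> \<le> length (paths_node c)"
    using card_length[of "map snd (paths_node c)"] by simp
  also have "\<dots> \<le> 2 ^ h" by (rule length_paths_node) (use c in \<open>auto simp: solves_def\<close>)
  finally show ?thesis by (simp add: card_image inj_on_def)
qed

subsection \<open>Irreducible annihilating words\<close>

text \<open>Decide where a row deviates from the values prescribed by an irreducible annihilating word: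
  one query certifies a deviation, but against the prescribed answers all but one of the letters
  have to be queried.\<close>

lemma irreducible_ann_length_le:
  assumes A: "closed_class A" and \<psi>: "bounded_cm \<psi>"
    and T: "T \<in> A" "rows T \<noteq> {}" "m_psi \<psi> T \<le> n" and w: "irreducible_ann T w"
    and H: "\<And>Q. Q \<in> A \<Longrightarrow> psi_a \<psi> Q \<le> n \<Longrightarrow> psi_d \<psi> Q \<le> h"
  shows "length w \<le> h + 1"
proof -
  have tab: "is_table T" using A T(1) by (rule closed_is_table)
  have fin: "finite (cols T)" using tab by (simp add: is_table_def)
  have ann: "annihilating T w" using w by (simp add: irreducible_ann_def)
  have dist: "distinct (map fst w)" by (rule irreducible_ann_distinct[OF w])
  have wcols: "set w \<subseteq> cols T \<times> E2" by (rule irreducible_ann_cols[OF w])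
  define B where "B = fst ` set w"
  have cardB: "card B = length w" using dist distinct_card unfolding B_def by fastforce
  \<comment> \<open>The prescribed values. The default 0 outside \<open>B\<close> matches the rows
    of the projected table, which are therefore equal to \<open>a\<close> everywhere except at their
    deviations.\<close>
  define a where "a = (\<lambda>i. if i \<in> B then the (map_of w i) else 0)"
  have a: "a i = d" if "(i, d) \<in> set w" for i d
  proof -
    have "i \<in> B" using that by (force simp: B_def)
    then show ?thesis using map_of_is_SomeI[OF dist that] by (simp add: a_def)
  qed
  have aE2: "a i \<in> E2" if i: "i \<in> B" for i
  proof -
    obtain d where "(i, d) \<in> set w" using i by (auto simp: B_def)
    then show ?thesis using a wcols by auto
  qed
  have flip: "1 - a i \<in> E2" "1 - a i \<noteq> a i" if "i \<in> B" for i
    using aE2[OF that] by (auto simp: E2_def)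
  have BT: "B \<subseteq> cols T" using wcols by (auto simp: B_def)
  have B: "B \<noteq> {}"
  proof
    assume "B = {}"
    then have "w = []" by (simp add: B_def)
    then show False using ann T(2) by (simp add: annihilating_def sub_rows_agrees)
  qed
  define f where "f = (\<lambda>r. {i \<in> B. r i \<noteq> a i})"
  define Q where "Q = restrict_tab T B f"
  have Qsimps: "cols Q = B" "rows Q = proj (cols T - B) ` rows T"
    "\<And>r. r \<in> rows Q \<Longrightarrow> dec Q r = f r"
    by (auto simp: Q_def)
  have finB: "finite B" by (simp add: B_def)
  have dev: "\<exists>i\<in>B. r i \<noteq> a i" if r: "r \<in> rows Q" for r
  proof -
    obtain s where s: "s \<in> rows T" "r = proj (cols T - B) s" using r by (auto simp: Qsimps)
    have "\<not> agrees s w" using ann s(1) by (auto simp: annihilating_def sub_rows_agrees)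
    then obtain i d where i: "(i, d) \<in> set w" "s i \<noteq> d" by (auto simp: agrees_def)
    then have "i \<in> B" by (force simp: B_def)
    then show ?thesis using a[OF i(1)] i(2) s(2) by auto
  qed
  have fPw: "f r \<in> Pw" if "r \<in> rows Q" for r
    using dev[OF that] finB by (auto simp: f_def Pw_def)
  have QA: "Q \<in> A"
    unfolding Q_def
    by (rule bracket_closed[OF A T(1) restrict_tab_bracket[OF BT B]]) (use fPw Qsimps in auto)
  have Qtab: "is_table Q" using A QA by (rule closed_is_table)
  have "psi_a \<psi> Q \<le> n"
  proof (rule psi_a_le[where P = "(\<lambda>i. ([(i, 1 - a i)], i)) ` B"])
    show "\<exists>(w, d)\<in>(\<lambda>i. ([(i, 1 - a i)], i)) ` B. agrees r w" if r: "r \<in> rows Q" for r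
    proof -
      obtain i where i: "i \<in> B" "r i \<noteq> a i" using dev[OF r] by blast
      have "r i \<in> E2" using is_table_E2[OF Qtab r] i(1) by (simp add: Qsimps)
      then have "agrees r [(i, 1 - a i)]" using i aE2[OF i(1)] by (auto simp: E2_def)
      then show ?thesis using i(1) by blast
    qed
    show "w \<in> Omega2 Q" "psi_w \<psi> w \<le> n"
      if wd: "(w, d) \<in> (\<lambda>i. ([(i, 1 - a i)], i)) ` B" for w d
    proof -
      obtain i where i: "i \<in> B" "w = [(i, 1 - a i)]" using wd by auto
      show "w \<in> Omega2 Q" using i flip by (simp add: Omega2_def Qsimps)
      have "\<psi> [i] \<le> m_psi \<psi> T" using fin i(1) BT by (intro m_psi_letter) auto
      then show "psi_w \<psi> w \<le> n" using i(2) T(3) by (simp add: psi_w_def)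
    qed
    show "d \<in> dec Q r"
      if wd: "(w, d) \<in> (\<lambda>i. ([(i, 1 - a i)], i)) ` B" and r: "r \<in> rows Q" "agrees r w"
      for w d r
    proof -
      have "d \<in> B" "w = [(d, 1 - a d)]" using wd by auto
      then show ?thesis using r flip(2)[of d] by (simp add: Qsimps(3) f_def)
    qed
  qed (use B finB in auto)
  then have h: "psi_d \<psi> Q \<le> h" by (rule H[OF QA])
  have "rows Q \<noteq> {}" using T(2) by (simp add: Qsimps)
  then obtain c where "solves Q (rows Q) (psi_d \<psi> Q) c"
    using psi_d_attained[OF \<psi> Qtab] by blast
  then have c: "solves Q (rows Q) h c" by (rule solves_mono) (use h in auto)
  \<comment> \<open>Deleting the letter of \<open>i\<close> from \<open>w\<close> leaves a word that
    is no longer annihilating. A row agreeing with it must deviate at \<open>i\<close>, because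
    \<open>w\<close> itself is annihilating.\<close>
  have only: "\<exists>r\<in>rows Q. f r = {i} \<and> (\<forall>j. j \<noteq> i \<longrightarrow> r j = a j)" if i: "i \<in> B" for i
  proof -
    obtain d where d: "(i, d) \<in> set w" using i by (auto simp: B_def)
    then obtain u v where uv: "w = u @ (i, d) # v" by (meson split_list)
    have "subseq (u @ v) w" unfolding uv by (intro list_emb_append_mono) auto
    then have "\<not> annihilating T (u @ v)" using w uv unfolding irreducible_ann_def by fastforce
    moreover have "u @ v \<in> Omega2 T"
      using ann uv by (auto simp: annihilating_def Omega2_def)
    moreover have "set (u @ v) \<subseteq> set w" by (auto simp: uv)
    then have "\<not> (\<exists>i d s. (i, d) \<in> set (u @ v) \<and> (i, s) \<in> set (u @ v) \<and> d \<noteq> s)"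
      using ann unfolding annihilating_def by blast
    ultimately have "sub_rows T (u @ v) \<noteq> {}" unfolding annihilating_def by blast
    then obtain s where s: "s \<in> rows T" "agrees s u" "agrees s v" by (auto simp: sub_rows_agrees)
    have "\<not> agrees s w" using ann s(1) by (auto simp: annihilating_def sub_rows_agrees)
    then have "s i \<noteq> d" using s by (simp add: uv)
    have eq: "proj (cols T - B) s j = a j" if j: "j \<noteq> i" for j
    proof (cases "j \<in> B")
      case True
      then obtain e where e: "(j, e) \<in> set w" by (auto simp: B_def)
      then have "(j, e) \<in> set u \<union> set v" using j by (auto simp: uv)
      then have "s j = e" using s by (auto simp: agrees_def)
      then show ?thesis using a[OF e] True by simp
    next
      case False
      then show ?thesis
        using is_table_outside[OF tab s(1), of j] by (simp add: proj_def a_def)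
    qed
    have "f (proj (cols T - B) s) = {i}"
      using eq i \<open>s i \<noteq> d\<close> a[OF d] by (auto simp: f_def)
    then show ?thesis using eq s(1) by (auto simp: Qsimps)
  qed
  \<comment> \<open>All answers follow \<open>a\<close>, so only the set \<open>S\<close> of queried
    attributes grows, by at most one per query.\<close>
  define Inv where "Inv = (\<lambda>(k :: nat) (S :: nat set) x. x = a \<and> finite S \<and> card S + k \<le> h)"
  have "\<exists>k' S' x'. Inv k' S' x' \<and> {} \<subseteq> S' \<and> (\<forall>j\<in>{}. x' j = a j) \<and>
    (\<forall>p\<in>set (paths_node c). \<forall>r. (\<forall>j\<in>S'. r j = x' j) \<longrightarrow> agrees r (fst p) \<longrightarrow>
       fst ` set (fst p) \<subseteq> S')"
  proof (rule adversary[where C = UNIV])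
    show "Inv h {} a" by (simp add: Inv_def)
    show "\<exists>S' x'. Inv k S' x' \<and> S \<subseteq> S' \<and> i \<in> S' \<and> (\<forall>j\<in>S. x' j = x j)"
      if I: "Inv (Suc k) S x" for k S x i
    proof (intro exI conjI)
      show "Inv k (insert i S) x" using I by (auto simp: Inv_def card_insert_if)
    qed auto
  qed (use c in \<open>auto simp: solves_def\<close>)
  then obtain k' S x' where "Inv k' S x'"
    and paths': "\<forall>p\<in>set (paths_node c). \<forall>r. (\<forall>j\<in>S. r j = x' j) \<longrightarrow> agrees r (fst p) \<longrightarrow>
        fst ` set (fst p) \<subseteq> S"
    by (elim exE conjE) (rule that)
  then have S: "finite S" "card S + k' \<le> h" "x' = a" by (simp_all add: Inv_def)
  have paths: "fst ` set (fst p) \<subseteq> S"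
    if "p \<in> set (paths_node c)" "\<forall>j\<in>S. r j = a j" "agrees r (fst p)" for p r
    using paths' that S(3) by simp
  \<comment> \<open>The rows deviating only at \<open>i\<close> and only at \<open>j\<close> cannot
    be told apart on \<open>S\<close>, so they share a leaf, whose decision must equal both. Hence
    at most one letter stays unqueried, the source of the \<open>+ 1\<close>.\<close>
  have "i = j" if ij: "i \<in> B - S" "j \<in> B - S" for i j
  proof -
    obtain r s where r: "r \<in> rows Q" "f r = {i}" "\<forall>k. k \<noteq> i \<longrightarrow> r k = a k"
      and s: "s \<in> rows Q" "f s = {j}" "\<forall>k. k \<noteq> j \<longrightarrow> s k = a k"
      using only[of i] only[of j] ij by blast
    have rS: "\<forall>k\<in>S. r k = a k" "\<forall>k\<in>S. s k = a k" using r(3) s(3) ij by auto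
    obtain p where p: "p \<in> set (paths_node c)" "agrees r (fst p)"
      using c r(1) unfolding solves_def by blast
    have "fst ` set (fst p) \<subseteq> S" using paths[OF p(1) rS(1) p(2)] .
    then have "agrees s (fst p)" using p(2) rS by (subst agrees_cong[of _ _ r]) auto
    then have "snd p \<in> dec Q r" "snd p \<in> dec Q s"
      using c p r(1) s(1) unfolding solves_def by blast+
    then show ?thesis using r(1,2) s(1,2) by (simp add: Qsimps(3))
  qed
  then have "card (B - S) \<le> 1" using finB by (simp add: card_le_Suc0_iff_eq)
  moreover have "card B - card S \<le> card (B - S)" using S(1) by (rule diff_card_le_card_Diff)
  ultimately show ?thesis using S(2) cardB by simp
qed

subsection \<open>Complete tables\<close>

text \<open>\<open>ones\<close> maps the rows injectively into the power set of the columns, and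
  completeness makes the cardinalities equal.\<close>

lemma complete_rows:
  assumes tab: "is_table T" and "complete_tab T"
    and x: "\<And>i. i \<in> cols T \<Longrightarrow> x i \<in> E2" "\<And>i. i \<notin> cols T \<Longrightarrow> x i = 0"
  shows "x \<in> rows T"
proof -
  have fin: "finite (cols T)" using tab by (simp add: is_table_def)
  have "card (ones ` rows T) = card (Pow (cols T))"
    using assms(2) fin card_image[OF inj_on_ones[OF tab]]
    by (simp add: complete_tab_def Ntab_def card_Pow)
  then have "ones ` rows T = Pow (cols T)"
    using fin ones_subset[OF tab] by (intro card_subset_eq) auto
  moreover have "ones x \<subseteq> cols T" using x(2) by (fastforce simp: ones_def)
  ultimately obtain r where r: "r \<in> rows T" "ones r = ones x"
    by (metis PowI imageE)
  have "r i = x i" for i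
  proof (cases "i \<in> cols T")
    case True
    have "r i = 1 \<longleftrightarrow> x i = 1" using r(2) by (auto simp: ones_def)
    then show ?thesis using is_table_E2[OF tab r(1) True] x(1)[OF True] by (auto simp: E2_def)
  qed (simp add: x(2) is_table_outside[OF tab r(1)])
  then show ?thesis using r(1) by (metis ext)
qed

text \<open>A row encodes a map from pigeons to holes: the hole of pigeon \<open>q\<close>, a subset of \<open>{..<b}\<close>, is
  stored in the attributes \<open>\<phi> (q, t)\<close> with \<open>t < b\<close>.\<close>

definition hole :: "(nat \<times> nat \<Rightarrow> nat) \<Rightarrow> nat \<Rightarrow> (nat \<Rightarrow> nat) \<Rightarrow> nat \<Rightarrow> nat set" where
  "hole \<phi> b x q = {t. t < b \<and> x (\<phi> (q, t)) = 1}"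

definition set_hole ::
  "(nat \<times> nat \<Rightarrow> nat) \<Rightarrow> nat \<Rightarrow> nat \<Rightarrow> nat set \<Rightarrow> (nat \<Rightarrow> nat) \<Rightarrow> nat \<Rightarrow> nat" where
  "set_hole \<phi> b q s x = (\<lambda>j. if j \<in> \<phi> ` ({q} \<times> {..<b})
     then (if j \<in> \<phi> ` ({q} \<times> s) then 1 else 0) else x j)"

definition hole_word :: "(nat \<times> nat \<Rightarrow> nat) \<Rightarrow> nat \<Rightarrow> nat \<Rightarrow> nat set \<Rightarrow> word" where
  "hole_word \<phi> b q s = map (\<lambda>t. (\<phi> (q, t), if t \<in> s then 1 else 0)) [0..<b]"

lemma agrees_hole_word:
  assumes "s \<subseteq> {..<b}" "\<And>t. t < b \<Longrightarrow> x (\<phi> (q, t)) \<in> E2"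
  shows "agrees x (hole_word \<phi> b q s) \<longleftrightarrow> hole \<phi> b x q = s"
proof -
  have "agrees x (hole_word \<phi> b q s) \<longleftrightarrow> (\<forall>t<b. x (\<phi> (q, t)) = (if t \<in> s then 1 else 0))"
    by (auto simp: agrees_def hole_word_def)
  also have "\<dots> \<longleftrightarrow> (\<forall>t<b. x (\<phi> (q, t)) = 1 \<longleftrightarrow> t \<in> s)"
  proof -
    have "x (\<phi> (q, t)) = (if t \<in> s then 1 else 0) \<longleftrightarrow> (x (\<phi> (q, t)) = 1 \<longleftrightarrow> t \<in> s)"
      if "t < b" for t
      using assms(2)[OF that] by (auto simp: E2_def)
    then show ?thesis by simp
  qed
  also have "\<dots> \<longleftrightarrow> hole \<phi> b x q = s" using assms(1) by (auto simp: hole_def)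
  finally show ?thesis .
qed

lemma hole_set_hole:
  assumes inj: "inj_on \<phi> (I \<times> {..<b})" and "q \<in> I" "q' \<in> I" "s \<subseteq> {..<b}"
  shows "hole \<phi> b (set_hole \<phi> b q s x) q' = (if q' = q then s else hole \<phi> b x q')"
proof -
  have eq: "\<phi> (q', t) = \<phi> (q, t') \<longleftrightarrow> q' = q \<and> t = t'" if "t < b" "t' < b" for t t'
    using inj_on_eq_iff[OF inj, of "(q', t)" "(q, t')"] that assms(2,3) by auto
  have 1: "\<phi> (q', t) \<in> \<phi> ` ({q} \<times> {..<b}) \<longleftrightarrow> q' = q" if t: "t < b" for t
    using eq[OF t] t by auto
  have 2: "\<phi> (q', t) \<in> \<phi> ` ({q} \<times> s) \<longleftrightarrow> q' = q \<and> t \<in> s" if t: "t < b" for t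
  proof
    assume "\<phi> (q', t) \<in> \<phi> ` ({q} \<times> s)"
    then obtain t' where t': "t' \<in> s" "\<phi> (q', t) = \<phi> (q, t')" by auto
    then have "t' < b" using assms(4) by auto
    then show "q' = q \<and> t \<in> s" using eq[OF t] t' by blast
  qed auto
  show ?thesis using 1 2 assms(4) by (auto simp: hole_def set_hole_def)
qed

lemma set_hole_unchanged: "j \<notin> \<phi> ` ({q} \<times> {..<b}) \<Longrightarrow> set_hole \<phi> b q s x j = x j"
  by (simp add: set_hole_def)

lemma set_hole_E2: "x j \<in> E2 \<Longrightarrow> set_hole \<phi> b q s x j \<in> E2"
  unfolding set_hole_def by (simp add: E2_def)

lemma image_blocks_disjoint:
  assumes "inj_on \<phi> (I \<times> J)" "F \<subseteq> I" "q \<in> I" "q \<notin> F" "j \<in> \<phi> ` (F \<times> J)"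
  shows "j \<notin> \<phi> ` ({q} \<times> J)"
proof -
  have "\<phi> ` (F \<times> J) \<inter> \<phi> ` ({q} \<times> J) = \<phi> ` ((F \<times> J) \<inter> ({q} \<times> J))"
    by (rule inj_on_image_Int[OF assms(1), symmetric]) (use assms(2,3) in auto)
  also have "\<dots> = {}" using assms(4) by auto
  finally show ?thesis using assms(5) by blast
qed

text \<open>The pigeonhole problem: \<open>2 ^ b + 1\<close> pigeons sit in \<open>2 ^ b\<close> holes, find two in the same hole.  A
  collision is certified by the \<open>2 * b\<close> bits of two pigeons, but an adversary that sends every newly
  queried pigeon to a fresh hole avoids collisions for \<open>2 ^ b\<close> queries.\<close>

lemma complete_lower_bound:
  assumes A: "closed_class A" and \<psi>: "bounded_cm \<psi>"
    and T: "T \<in> A" "complete_tab T" and letters: "\<And>i. i \<in> cols T \<Longrightarrow> \<psi> [i] \<le> n"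
    and b: "1 \<le> b" "(2 ^ b + 1) * b \<le> card (cols T)"
    and H: "\<And>Q. Q \<in> A \<Longrightarrow> psi_a \<psi> Q \<le> 2 * b * n \<Longrightarrow> psi_d \<psi> Q \<le> h"
  shows "2 ^ b < h"
proof (rule ccontr)
  assume "\<not> 2 ^ b < h"
  then have hb: "h \<le> 2 ^ b" by simp
  have tab: "is_table T" using A T(1) by (rule closed_is_table)
  have fin: "finite (cols T)" using tab by (simp add: is_table_def)
  define I where "I = {..(2::nat) ^ b}"
  have "card (I \<times> {..<b}) \<le> card (cols T)" using b(2) by (simp add: I_def card_cartesian_product)
  then obtain \<phi> where \<phi>: "\<phi> ` (I \<times> {..<b}) \<subseteq> cols T" "inj_on \<phi> (I \<times> {..<b})"
    using card_le_inj[of "I \<times> {..<b}" "cols T"] fin by (auto simp: I_def)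
  define B where "B = \<phi> ` (I \<times> {..<b})"
  have B: "B \<subseteq> cols T" "B \<noteq> {}" using \<phi>(1) b(1) by (auto simp: B_def I_def lessThan_empty_iff)
  \<comment> \<open>The order \<open>i < j\<close> excludes trivial pairs and names each collision
    once.\<close>
  define f where "f = (\<lambda>r. {prod_encode (i, j) | i j. i < j \<and> j \<in> I \<and> hole \<phi> b r i = hole \<phi> b r j})"
  define Q where "Q = restrict_tab T B f"
  have Qsimps: "cols Q = B" "rows Q = proj (cols T - B) ` rows T"
    "\<And>r. r \<in> rows Q \<Longrightarrow> dec Q r = f r"
    by (auto simp: Q_def)
  have holes: "hole \<phi> b r q \<in> Pow {..<b}" for r q by (auto simp: hole_def)
  have down: "i \<in> I" if "i < j" "j \<in> I" for i j using that by (auto simp: I_def)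
  have collision: "\<exists>i j. i < j \<and> j \<in> I \<and> hole \<phi> b r i = hole \<phi> b r j" for r
  proof -
    have "card (hole \<phi> b r ` I) \<le> card (Pow {..<b})" using holes by (intro card_mono) auto
    also have "\<dots> < card I" by (simp add: card_Pow I_def)
    finally have "\<not> inj_on (hole \<phi> b r) I" by (rule pigeonhole)
    then obtain i j where "i \<in> I" "j \<in> I" "i \<noteq> j" "hole \<phi> b r i = hole \<phi> b r j"
      by (auto simp: inj_on_def)
    then show ?thesis by (metis nat_neq_iff)
  qed
  have fPw: "f r \<in> Pw" for r
  proof -
    have "f r \<subseteq> prod_encode ` (I \<times> I)" using down by (auto simp: f_def)
    then have "finite (f r)" by (rule finite_subset) (simp add: I_def)
    then show ?thesis using collision[of r] by (auto simp: f_def Pw_def)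
  qed
  have QA: "Q \<in> A"
    unfolding Q_def by (rule bracket_closed[OF A T(1) restrict_tab_bracket[OF B fPw]])
  have Qtab: "is_table Q" using A QA by (rule closed_is_table)
  have rowsQ: "x \<in> rows Q" if x: "\<And>i. x i \<in> E2" "\<And>i. i \<notin> B \<Longrightarrow> x i = 0" for x
  proof -
    have "x \<in> rows T" using x B(1) by (intro complete_rows[OF tab T(2)]) blast+
    moreover have "proj (cols T - B) x = x" using x(2) by (auto simp: proj_def)
    ultimately show ?thesis unfolding Qsimps by (metis image_eqI)
  qed
  have E2Q: "r (\<phi> (i, t)) \<in> E2" if "r \<in> rows Q" "i \<in> I" "t < b" for r i t
    using is_table_E2[OF Qtab that(1)] that(2,3) by (auto simp: Qsimps B_def)
  have ahw: "agrees r (hole_word \<phi> b i s) \<longleftrightarrow> hole \<phi> b r i = s"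
    if r: "r \<in> rows Q" and i: "i \<in> I" and s: "s \<subseteq> {..<b}" for r i s
    using s by (rule agrees_hole_word) (rule E2Q[OF r i])
  define P where "P = {(hole_word \<phi> b i s @ hole_word \<phi> b j s, prod_encode (i, j)) | i j s.
     i < j \<and> j \<in> I \<and> s \<subseteq> {..<b}}"
  have "psi_a \<psi> Q \<le> 2 * b * n"
  proof (rule psi_a_le[of P])
    have "P \<subseteq> (\<lambda>(i, j, s). (hole_word \<phi> b i s @ hole_word \<phi> b j s, prod_encode (i, j)))
        ` (I \<times> I \<times> Pow {..<b})"
      using down by (auto simp: P_def image_iff)
    then show "finite P" by (rule finite_subset) (simp add: I_def)
    have cover: "\<exists>(w, d)\<in>P. agrees r w" if r: "r \<in> rows Q" for r
    proof -
      obtain i j where ij: "i < j" "j \<in> I" "hole \<phi> b r i = hole \<phi> b r j"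
        using collision[of r] by blast
      have s: "hole \<phi> b r j \<subseteq> {..<b}" using holes by auto
      have "(hole_word \<phi> b i (hole \<phi> b r j) @ hole_word \<phi> b j (hole \<phi> b r j), prod_encode (i, j)) \<in> P"
        using ij(1,2) s unfolding P_def by blast
      moreover have "agrees r (hole_word \<phi> b i (hole \<phi> b r j) @ hole_word \<phi> b j (hole \<phi> b r j))"
        using ahw[OF r ij(2) s] ahw[OF r down[OF ij(1,2)] s] ij(3) by simp
      ultimately show ?thesis by blast
    qed
    then show "\<exists>(w, d)\<in>P. agrees r w" if "r \<in> rows Q" for r using that .
    have "(\<lambda>_. 0) \<in> rows Q" by (rule rowsQ) (auto simp: E2_def)
    then show "P \<noteq> {}" using cover by blast
    have wP: "w \<in> Omega2 Q \<and> length w = 2 * b" if wd: "(w, d) \<in> P" for w d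
    proof -
      obtain i j s where ij: "i < j" "j \<in> I" "s \<subseteq> {..<b}"
        "w = hole_word \<phi> b i s @ hole_word \<phi> b j s" using wd unfolding P_def by blast
      then show ?thesis using down[OF ij(1,2)]
        by (auto simp: Omega2_def Qsimps B_def E2_def hole_word_def)
    qed
    then show "w \<in> Omega2 Q" if "(w, d) \<in> P" for w d using that by blast
    show "psi_w \<psi> w \<le> 2 * b * n" if "(w, d) \<in> P" for w d
    proof -
      have "\<psi> (map fst w) \<le> length (map fst w) * n"
        using wP[OF that] letters B(1)
        by (intro bounded_cm_le_length_mult[OF \<psi>]) (auto simp: Omega2_def Qsimps)
      then show ?thesis using wP[OF that] by (simp add: psi_w_def)
    qed
    show "d \<in> dec Q r" if wd: "(w, d) \<in> P" and r: "r \<in> rows Q" "agrees r w" for w d r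
    proof -
      obtain i j s where ij: "i < j" "j \<in> I" "s \<subseteq> {..<b}"
        "w = hole_word \<phi> b i s @ hole_word \<phi> b j s" "d = prod_encode (i, j)"
        using wd unfolding P_def by blast
      have "hole \<phi> b r i = s" "hole \<phi> b r j = s"
        using ahw[OF r(1) ij(2,3)] ahw[OF r(1) down[OF ij(1,2)] ij(3)] r(2) ij(4) by simp_all
      then show ?thesis using ij(1,2,5) unfolding Qsimps(3)[OF r(1)] f_def by blast
    qed
  qed
  then have h: "psi_d \<psi> Q \<le> 2 ^ b" using H[OF QA] hb by simp
  have zero: "(\<lambda>_. 0) \<in> rows Q" by (rule rowsQ) (auto simp: E2_def)
  then obtain c where "solves Q (rows Q) (psi_d \<psi> Q) c"
    using psi_d_attained[OF \<psi> Qtab] by blast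
  then have c: "solves Q (rows Q) (2 ^ b) c" by (rule solves_mono) (use h in auto)
  \<comment> \<open>The first query to a pigeon places it for good: all \<open>b\<close> bits of its
    block are promised. Thus \<open>S\<close> consists of the blocks of the placed pigeons
    \<open>F\<close>, which sit in different holes and number at most one per query.\<close>
  define Inv where "Inv = (\<lambda>k S (x :: nat \<Rightarrow> nat). \<exists>F. F \<subseteq> I \<and> S = \<phi> ` (F \<times> {..<b}) \<and> inj_on (hole \<phi> b x) F \<and>
     card F + k \<le> 2 ^ b \<and> (\<forall>i. x i \<in> E2) \<and> (\<forall>i. i \<notin> B \<longrightarrow> x i = 0))"
  have "\<exists>k' S' x'. Inv k' S' x' \<and> {} \<subseteq> S' \<and> (\<forall>j\<in>{}. x' j = (\<lambda>_. 0) j) \<and>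
    (\<forall>p\<in>set (paths_node c). \<forall>r. (\<forall>j\<in>S'. r j = x' j) \<longrightarrow> agrees r (fst p) \<longrightarrow>
       fst ` set (fst p) \<subseteq> S')"
  proof (rule adversary[where C = B])
    show "Inv (2 ^ b) {} (\<lambda>_. 0)"
      unfolding Inv_def by (intro exI[of _ "{}"]) (simp add: E2_def)
    show "\<exists>S' x'. Inv k S' x' \<and> S \<subseteq> S' \<and> i \<in> S' \<and> (\<forall>j\<in>S. x' j = x j)"
      if I: "Inv (Suc k) S x" and i: "i \<in> B" for k S x i
    proof -
      obtain F where F: "F \<subseteq> I" "S = \<phi> ` (F \<times> {..<b})" "inj_on (hole \<phi> b x) F"
        "card F + Suc k \<le> 2 ^ b" and x: "\<forall>i. x i \<in> E2" "\<forall>i. i \<notin> B \<longrightarrow> x i = 0"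
        using I unfolding Inv_def by blast
      have finF: "finite F" using F(1) finite_subset by (auto simp: I_def)
      obtain q t where q: "q \<in> I" "t < b" "i = \<phi> (q, t)" using i by (auto simp: B_def)
      show ?thesis
      proof (cases "q \<in> F")
        case True
        \<comment> \<open>The pigeon is already placed, so the answer is fixed; the query only uses
          up budget.\<close>
        have "Inv k S x" unfolding Inv_def using F x by (intro exI[of _ F]) auto
        moreover have "i \<in> S" using True q F(2) by auto
        ultimately show ?thesis by (intro exI[of _ S] exI[of _ x]) auto
      next
        case False
        \<comment> \<open>Fewer than \<open>2 ^ b\<close> pigeons are placed before the budget runs
          out, so some hole is free for \<open>q\<close>.\<close>
        have "card (hole \<phi> b x ` F) \<le> card F" using finF by (rule card_image_le)
        also have "\<dots> < card (Pow {..<b})" using F(4) by (simp add: card_Pow)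
        finally have "hole \<phi> b x ` F \<noteq> Pow {..<b}" by auto
        then obtain s where s: "s \<subseteq> {..<b}" "s \<notin> hole \<phi> b x ` F" using holes by blast
        define x' where "x' = set_hole \<phi> b q s x"
        have hx': "hole \<phi> b x' q' = (if q' = q then s else hole \<phi> b x q')" if "q' \<in> I" for q'
          unfolding x'_def by (rule hole_set_hole[OF \<phi>(2) q(1) that s(1)])
        have same: "x' j = x j" if j: "j \<in> S" for j
          unfolding x'_def
          by (rule set_hole_unchanged[OF image_blocks_disjoint[OF \<phi>(2) F(1) q(1) False]])
            (use j F(2) in simp)
        have "inj_on (hole \<phi> b x') (insert q F)"
        proof -
          have eqF: "hole \<phi> b x' q' = hole \<phi> b x q'" if q': "q' \<in> F" for q'
          proof -
            have "q' \<in> I" "q' \<noteq> q" using q' F(1) False by auto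
            then show ?thesis using hx' by simp
          qed
          then have "inj_on (hole \<phi> b x') F" using F(3) by (simp cong: inj_on_cong)
          moreover have "hole \<phi> b x' ` F = hole \<phi> b x ` F" using eqF by (rule image_cong[OF refl])
          ultimately show ?thesis using s(2) hx'[OF q(1)] False by simp
        qed
        moreover have "card (insert q F) + k \<le> 2 ^ b" using False finF F(4) by simp
        moreover have "\<forall>i. x' i \<in> E2" using x(1) by (auto simp: x'_def intro: set_hole_E2)
        moreover have "\<forall>i. i \<notin> B \<longrightarrow> x' i = 0"
        proof (intro allI impI)
          fix j assume j: "j \<notin> B"
          then have "x' j = x j" unfolding x'_def using q(1)
            by (intro set_hole_unchanged) (auto simp: B_def)
          then show "x' j = 0" using x(2) j by simp
        qed
        ultimately have "Inv k (\<phi> ` (insert q F \<times> {..<b})) x'"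
          unfolding Inv_def using F(1) q(1) by (intro exI[of _ "insert q F"]) auto
        moreover have "S \<subseteq> \<phi> ` (insert q F \<times> {..<b})" unfolding F(2) by auto
        moreover have "i \<in> \<phi> ` (insert q F \<times> {..<b})" using q by auto
        ultimately show ?thesis using same by blast
      qed
    qed
  qed (use c in \<open>auto simp: solves_def Qsimps\<close>)
  then obtain k' S x where "Inv k' S x"
    and paths: "\<forall>p\<in>set (paths_node c). \<forall>r. (\<forall>j\<in>S. r j = x j) \<longrightarrow> agrees r (fst p) \<longrightarrow>
        fst ` set (fst p) \<subseteq> S" by (elim exE conjE) (rule that)
  then obtain F where F: "F \<subseteq> I" "S = \<phi> ` (F \<times> {..<b})" "inj_on (hole \<phi> b x) F"
    and x: "\<And>i. x i \<in> E2" "\<And>i. i \<notin> B \<Longrightarrow> x i = 0"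
    unfolding Inv_def by blast
  have xQ: "x \<in> rows Q" using x by (rule rowsQ)
  then obtain p where p: "p \<in> set (paths_node c)" "agrees x (fst p)"
    using c unfolding solves_def by blast
  have pS: "fst ` set (fst p) \<subseteq> S" using paths p by blast
  have dec: "snd p \<in> f r" if r: "r \<in> rows Q" "\<And>j. j \<in> S \<Longrightarrow> r j = x j" for r
  proof -
    have "agrees r (fst p)" using p(2) pS r(2) by (subst agrees_cong[of _ _ x]) auto
    then show ?thesis using c p(1) r(1) unfolding solves_def by (simp add: Qsimps(3))
  qed
  obtain i j where ij: "i < j" "j \<in> I" "snd p = prod_encode (i, j)"
    "hole \<phi> b x i = hole \<phi> b x j" using dec[OF xQ] by (auto simp: f_def)
  have iI: "i \<in> I" by (rule down[OF ij(1,2)])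
  \<comment> \<open>The pair named by the leaf collides in \<open>x\<close>, but placed pigeons do
    not collide, so one of the two is not placed. Moving it to another hole keeps all promised
    values, hence the leaf, and destroys the collision.\<close>
  have "\<not> (i \<in> F \<and> j \<in> F)" using ij(1,4) F(3) by (auto dest: inj_onD)
  then obtain q q' where q: "q \<in> I" "q' \<in> I" "q \<notin> F" "q \<noteq> q'" "{q, q'} = {i, j}"
    using ij(1,2) iI by (metis insert_commute nat_neq_iff)
  \<comment> \<open>The holes \<open>{}\<close> and \<open>{0}\<close> differ because
    \<open>b\<close> is at least 1.\<close>
  obtain s where s: "s \<subseteq> {..<b}" "s \<noteq> hole \<phi> b x q'"
  proof (cases "hole \<phi> b x q' = {}")
    case True
    then show ?thesis using that[of "{0}"] b(1) by auto
  next
    case False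
    then show ?thesis using that[of "{}"] by auto
  qed
  define y where "y = set_hole \<phi> b q s x"
  have yS: "y j = x j" if "j \<in> S" for j
    unfolding y_def using that F(2)
    by (intro set_hole_unchanged image_blocks_disjoint[OF \<phi>(2) F(1) q(1,3)]) simp
  have "y \<in> rows Q"
  proof (rule rowsQ)
    show "y i \<in> E2" for i using x(1) by (simp add: y_def set_hole_E2)
    show "y i = 0" if i: "i \<notin> B" for i
    proof -
      have "i \<notin> \<phi> ` ({q} \<times> {..<b})" using i q(1) by (auto simp: B_def)
      then show ?thesis using x(2)[OF i] by (simp add: y_def set_hole_unchanged)
    qed
  qed
  then have "snd p \<in> f y" using yS by (rule dec)
  then have "hole \<phi> b y i = hole \<phi> b y j" unfolding ij(3) f_def by auto
  then have "hole \<phi> b y q = hole \<phi> b y q'" using q(5) by (metis doubleton_eq_iff)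
  then show False
    using hole_set_hole[OF \<phi>(2) q(1) q(1) s(1), of x] hole_set_hole[OF \<phi>(2) q(1) q(2) s(1), of x]
      q(4) s(2) by (simp add: y_def)
qed

subsection \<open>Arithmetic\<close>

text \<open>Replaces a real polynomial, whose coefficients may be negative or fractional, by a bound
  over the naturals. The induction is Horner's scheme.\<close>

lemma real_poly_le_power:
  fixes p :: "real poly"
  shows "\<exists>C d :: nat. \<forall>n :: nat. poly p (real n) \<le> real (C * (n + 1) ^ d)"
proof (induction p)
  case 0
  then show ?case by (intro exI[of _ 0]) simp
next
  case (pCons a p)
  then obtain C d where IH: "\<And>n :: nat. poly p (real n) \<le> real (C * (n + 1) ^ d)" by blast
  obtain m :: nat where m: "a \<le> real m" using real_arch_simple by blast
  have "poly (pCons a p) (real n) \<le> real ((m + C) * (n + 1) ^ Suc d)" for n :: nat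
  proof -
    have "real n * poly p (real n) \<le> real n * real (C * (n + 1) ^ d)"
      by (rule mult_left_mono[OF IH]) simp
    moreover have "real n * real (C * (n + 1) ^ d) = real (n * (C * (n + 1) ^ d))" by simp
    moreover have "m + n * (C * (n + 1) ^ d) \<le> (m + C) * (n + 1) ^ Suc d"
    proof -
      have "m * 1 \<le> m * (n + 1) ^ Suc d" 
        by (rule mult_left_mono[OF one_le_power]) simp_all
      moreover have "n * (C * (n + 1) ^ d) \<le> (n + 1) * (C * (n + 1) ^ d)"
        by (rule mult_right_mono) simp_all
      ultimately show ?thesis by (simp add: algebra_simps)
    qed
    then have "real (m + n * (C * (n + 1) ^ d)) \<le> real ((m + C) * (n + 1) ^ Suc d)"
      by (rule of_nat_mono)
    ultimately show ?thesis using m by simp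
  qed
  then show ?case by blast
qed

lemma ex_nat_poly:
  "\<exists>p :: real poly. \<forall>n. poly p (real n) = real (C * (n + 1) ^ d)"
  by (rule exI[of _ "smult (real C) ([:1, 1:] ^ d)"]) (simp add: poly_power add.commute)

text \<open>From \<open>b < d * (b div d + 1)\<close> and \<open>m + 1 \<le> 2 ^ m\<close>, the base
  \<open>2 * b + 1\<close> is at most \<open>2 * d * 2 ^ (b div d)\<close>; raising this to the
  power \<open>d\<close> costs only \<open>2 ^ b\<close>.\<close>

lemma power_le_exp: "(2 * b + 1) ^ d \<le> (2 * d) ^ d * (2 :: nat) ^ b"
proof (cases "d = 0")
  case False
  have "b < d * (b div d + 1)" using False dividend_less_times_div[of d b] by simp
  then have "2 * b + 1 \<le> 2 * d * (b div d + 1)" by simp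
  also have "\<dots> \<le> 2 * d * 2 ^ (b div d)" by (intro mult_left_mono) (simp_all add: Suc_le_eq)
  finally have "(2 * b + 1) ^ d \<le> (2 * d * 2 ^ (b div d)) ^ d" by (rule power_mono) simp
  also have "\<dots> = (2 * d) ^ d * 2 ^ (b div d * d)" by (simp add: power_mult_distrib power_mult)
  also have "\<dots> \<le> (2 * d) ^ d * 2 ^ b" by (intro mult_left_mono power_increasing) auto
  finally show ?thesis .
qed simp

text \<open>Removes \<open>b\<close> from the right-hand side. After squaring, the left side is
  \<open>2 ^ b * 2 ^ b\<close>, while the power of \<open>2 * b + 1\<close> on the right needs just
  one factor \<open>2 ^ b\<close> by \<open>power_le_exp\<close> with exponent \<open>2 * d\<close>;
  that factor cancels.\<close>

lemma exp_le_power_imp: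
  fixes b n d C :: nat
  assumes "2 ^ b \<le> C * (2 * b * n + 1) ^ d"
  shows "2 ^ b \<le> C\<^sup>2 * (4 * d) ^ (2 * d) * (n + 1) ^ (2 * d)"
proof -
  have "2 * b * n + 1 \<le> (2 * b + 1) * (n + 1)" by simp
  then have "(2 * b * n + 1) ^ (2 * d) \<le> ((2 * b + 1) * (n + 1)) ^ (2 * d)" by (rule power_mono) simp
  also have "\<dots> = (2 * b + 1) ^ (2 * d) * (n + 1) ^ (2 * d)" by (rule power_mult_distrib)
  also have "\<dots> \<le> ((4 * d) ^ (2 * d) * 2 ^ b) * (n + 1) ^ (2 * d)"
    using power_le_exp[of b "2 * d"] by (intro mult_right_mono) simp_all
  finally have le: "(2 * b * n + 1) ^ (2 * d) \<le> ((4 * d) ^ (2 * d) * 2 ^ b) * (n + 1) ^ (2 * d)" .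
  have "2 ^ b * 2 ^ b = (2 ^ b :: nat)\<^sup>2" by (simp add: power2_eq_square)
  also have "\<dots> \<le> (C * (2 * b * n + 1) ^ d)\<^sup>2" by (rule power_mono[OF assms]) simp
  also have "\<dots> = C\<^sup>2 * (2 * b * n + 1) ^ (2 * d)"
    by (simp add: power_mult_distrib power_mult[symmetric] mult.commute)
  also have "\<dots> \<le> C\<^sup>2 * (((4 * d) ^ (2 * d) * 2 ^ b) * (n + 1) ^ (2 * d))"
    by (rule mult_left_mono[OF le]) simp
  also have "\<dots> = 2 ^ b * (C\<^sup>2 * (4 * d) ^ (2 * d) * (n + 1) ^ (2 * d))"
    by (simp only: mult_ac)
  finally show ?thesis by simp
qed

text \<open>Take \<open>b\<close> just before the first size that no longer fits into
  \<open>k\<close> columns. The failure at \<open>b + 1\<close> bounds \<open>k\<close>, with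
  \<open>3\<close> from \<open>2 * 2 ^ b + 1 \<le> 3 * 2 ^ b\<close> and the square from
  \<open>b + 1 \<le> 2 ^ b\<close>.\<close>

lemma ex_pigeonhole_size:
  "\<exists>b. (2 ^ b + 1) * b \<le> k \<and> k < 3 * (2 ^ b)\<^sup>2" for k :: nat
proof -
  define P where "P = (\<lambda>b. k < (2 ^ b + 1) * b)"
  have "P (Suc k)" by (simp add: P_def)
  then have least: "P (LEAST b. P b)" by (rule LeastI)
  then have "(LEAST b. P b) \<noteq> 0" by (auto simp: P_def intro: ccontr)
  then obtain b where b: "(LEAST b. P b) = Suc b" by (auto simp: gr0_conv_Suc)
  then have "\<not> P b" using not_less_Least[of b P] by simp
  moreover have "k < 3 * (2 ^ b)\<^sup>2"
  proof -
    have "k < (2 ^ Suc b + 1) * Suc b" using least unfolding b by (simp only: P_def)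
    then have "k < (2 * 2 ^ b + 1) * (b + 1)" by simp
    also have "\<dots> \<le> (3 * 2 ^ b) * 2 ^ b"
    proof (rule mult_mono)
      show "2 * 2 ^ b + 1 \<le> 3 * (2 :: nat) ^ b" using one_le_power[of "2 :: nat" b] by linarith
      show "b + 1 \<le> 2 ^ b" by (simp add: Suc_le_eq)
    qed simp_all
    finally show ?thesis by (simp add: power2_eq_square mult.assoc)
  qed
  ultimately show ?thesis by (auto simp: P_def not_less)
qed

lemma max_if_finite_le:
  assumes "S \<noteq> {}" "\<And>x. x \<in> S \<Longrightarrow> x \<le> b"
  shows "\<exists>m. max_if_finite S = Some m \<and> m \<le> b"
proof -
  have "finite S" using assms(2) by (meson finite_nat_set_iff_bounded_le)
  then show ?thesis using assms by (simp add: max_if_finite_def)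
qed

lemma max_if_finite_ge: "max_if_finite S = Some m \<Longrightarrow> x \<in> S \<Longrightarrow> x \<le> m"
  by (auto simp: max_if_finite_def split: if_splits)

lemma max_if_finite_mem: "max_if_finite S = Some m \<Longrightarrow> S \<noteq> {} \<Longrightarrow> m \<in> S"
  by (metis Max_in max_if_finite_def option.distinct(1) option.inject)

theorem theorem4:
  fixes A :: "dtable set" and \<psi> :: "nat list \<Rightarrow> nat"
  assumes "closed_class A" and "nontrivial A" and "bounded_cm \<psi>"
    and "\<forall>n. H_fun \<psi> A n \<noteq> None"
  shows "(\<exists>p0 :: real poly. \<forall>n. real (the (H_fun \<psi> A n)) \<le> poly p0 (real n))
     \<longleftrightarrow> (\<exists>p1 p2 p3 :: real poly. \<forall>n.
            (\<exists>z. Z_fun \<psi> A n = Some z \<and> real z \<le> poly p1 (real n))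
          \<and> (\<exists>g. G_fun \<psi> A n = Some g \<and> real g \<le> poly p2 (real n))
          \<and> (\<exists>l. L_fun \<psi> A n = Some l \<and> real l \<le> 2 powr poly p3 (real n)))"
    (is "?lhs \<longleftrightarrow> ?rhs")
proof -
  note A = assms(1) and \<psi> = assms(3)
  have tab: "is_table T" if "T \<in> A" for T using A that by (rule closed_is_table)
  define H where "H = (\<lambda>n. the (H_fun \<psi> A n))"
  have H_Some: "max_if_finite (psi_d \<psi> ` {T \<in> A. psi_a \<psi> T \<le> n}) = Some (H n)" for n
    using assms(4) unfolding H_def by (simp add: H_fun_def[symmetric])
  have H_ge: "psi_d \<psi> T \<le> H n" if "T \<in> A" "psi_a \<psi> T \<le> n" for T n
    by (rule max_if_finite_ge[OF H_Some]) (use that in auto)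
  \<comment> \<open>The empty table keeps every set whose maximum is taken below nonempty, for every
    \<open>n\<close>.\<close>
  have Lam: "Lam \<in> A" "psi_a \<psi> Lam = 0" "m_psi \<psi> Lam = 0"
    using Lam_in_closed[OF A] by (auto simp: psi_a_def m_psi_def Lam_def)
  then have A_psi_ne: "A_psi \<psi> A n \<noteq> {}" for n by (auto simp: A_psi_def)
  show ?thesis
  proof
    assume ?lhs
    then obtain p0 where p0: "\<And>n. real (H n) \<le> poly p0 (real n)" by (auto simp: H_def)
    obtain C0 d where "\<And>n :: nat. poly p0 (real n) \<le> real (C0 * (n + 1) ^ d)"
      using real_poly_le_power by blast
    then have "real (H n) \<le> real (C0 * (n + 1) ^ d)" for n using p0 order_trans by blast
    then have HC0: "H n \<le> C0 * (n + 1) ^ d" for n using of_nat_le_iff by blast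
    \<comment> \<open>A positive constant makes \<open>M n\<close> at least 1, which settles the
      case \<open>b = 0\<close> below, where there is no pigeonhole instance.\<close>
    define C where "C = Suc C0"
    have HC: "H n \<le> C * (n + 1) ^ d" for n
      using HC0[of n] by (rule order_trans) (simp add: C_def)
    define M where "M = (\<lambda>n. C\<^sup>2 * (4 * d) ^ (2 * d) * (n + 1) ^ (2 * d))"
    have M1: "1 \<le> M n" for n
    proof -
      have "0 < (4 * d) ^ (2 * d)" by (cases "d = 0") auto
      then have "0 < M n" by (simp add: M_def C_def)
      then show ?thesis by simp
    qed
    have Z: "Zpar T \<le> 3 * (M n)\<^sup>2" if T: "T \<in> A" "m_psi \<psi> T \<le> n" for T n
    proof (rule Zpar_le[OF tab[OF T(1)]])
      fix Q assume Q: "Q \<in> bracket T" "complete_tab Q"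
      have QA: "Q \<in> A" by (rule bracket_closed[OF A T(1) Q(1)])
      have letters: "\<psi> [i] \<le> n" if "i \<in> cols Q" for i
      proof -
        have "i \<in> cols T" using bracket_cols_subset[OF Q(1)] that by blast
        moreover have "finite (cols T)" using tab[OF T(1)] by (simp add: is_table_def)
        ultimately have "\<psi> [i] \<le> m_psi \<psi> T" by (intro m_psi_letter)
        then show ?thesis using T(2) by simp
      qed
      obtain b where b: "(2 ^ b + 1) * b \<le> card (cols Q)" "card (cols Q) < 3 * (2 ^ b)\<^sup>2"
        using ex_pigeonhole_size by blast
      have "2 ^ b \<le> M n"
      proof (cases "b = 0")
        case True
        then show ?thesis using M1[of n] by simp
      next
        case False
        then have "2 ^ b < H (2 * b * n)"
          using complete_lower_bound[OF A \<psi> QA Q(2) letters _ b(1) H_ge] by simp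
        then have "2 ^ b \<le> C * (2 * b * n + 1) ^ d" using HC[of "2 * b * n"] by simp
        then show ?thesis unfolding M_def by (rule exp_le_power_imp)
      qed
      then have "(2 ^ b)\<^sup>2 \<le> (M n)\<^sup>2" by (rule power_mono) simp
      then show "card (cols Q) \<le> 3 * (M n)\<^sup>2" using b(2) by linarith
    qed
    have G: "Gpar T \<le> H n + 1" if T: "T \<in> A" "m_psi \<psi> T \<le> n" for T n
      by (rule Gpar_le[OF tab[OF T(1)]])
        (rule irreducible_ann_length_le[OF A \<psi> T(1) _ T(2) _ H_ge])
    have L: "l_psi \<psi> T n \<le> 2 ^ H n" if T: "T \<in> A" for T n
      by (rule l_psi_le[OF \<psi> tab[OF T]]) (rule irreducible_cover_card_le[OF A \<psi> T _ _ H_ge])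
    obtain p1 :: "real poly" where
      p1: "\<And>n. poly p1 (real n) = real (3 * (C\<^sup>2 * (4 * d) ^ (2 * d))\<^sup>2 * (n + 1) ^ (2 * d * 2))"
      using ex_nat_poly by blast
    have p1M: "poly p1 (real n) = real (3 * (M n)\<^sup>2)" for n
      unfolding p1 M_def by (simp only: power_mult_distrib power_mult mult_ac)
    show ?rhs
    proof (rule exI[of _ p1], rule exI[of _ "p0 + 1"], rule exI[of _ p0], intro allI conjI)
      fix n
      have "\<exists>z. Z_fun \<psi> A n = Some z \<and> z \<le> 3 * (M n)\<^sup>2"
        unfolding Z_fun_def by (rule max_if_finite_le) (use A_psi_ne Z in \<open>auto simp: A_psi_def\<close>)
      then show "\<exists>z. Z_fun \<psi> A n = Some z \<and> real z \<le> poly p1 (real n)"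
        unfolding p1M using of_nat_mono by blast
      have "\<exists>g. G_fun \<psi> A n = Some g \<and> g \<le> H n + 1"
        unfolding G_fun_def by (rule max_if_finite_le) (use A_psi_ne G in \<open>auto simp: A_psi_def\<close>)
      then obtain g where "G_fun \<psi> A n = Some g" "g \<le> H n + 1" by blast
      then show "\<exists>g. G_fun \<psi> A n = Some g \<and> real g \<le> poly (p0 + 1) (real n)"
        using p0[of n] by (intro exI[of _ g]) simp
      have "\<exists>l. L_fun \<psi> A n = Some l \<and> l \<le> 2 ^ H n"
        unfolding L_fun_def by (rule max_if_finite_le) (use Lam(1) L in auto)
      then obtain l where l: "L_fun \<psi> A n = Some l" "l \<le> 2 ^ H n" by blast
      have "real l \<le> 2 ^ H n" using l(2) by (metis of_nat_le_iff of_nat_numeral of_nat_power)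
      also have "\<dots> = 2 powr real (H n)" by (simp add: powr_realpow)
      also have "\<dots> \<le> 2 powr poly p0 (real n)" using p0 by simp
      finally show "\<exists>l. L_fun \<psi> A n = Some l \<and> real l \<le> 2 powr poly p0 (real n)"
        using l(1) by blast
    qed
  next
    assume ?rhs
    then obtain p1 p2 p3 :: "real poly" where
      p1: "\<And>n. \<exists>z. Z_fun \<psi> A n = Some z \<and> real z \<le> poly p1 (real n)" and
      p2: "\<And>n. \<exists>g. G_fun \<psi> A n = Some g \<and> real g \<le> poly p2 (real n)" and
      p3: "\<And>n. \<exists>l. L_fun \<psi> A n = Some l \<and> real l \<le> 2 powr poly p3 (real n)"
      by blast
    obtain C1 d1 where z: "\<And>n :: nat. poly p1 (real n) \<le> real (C1 * (n + 1) ^ d1)"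
      using real_poly_le_power by blast
    obtain C2 d2 where g: "\<And>n :: nat. poly p2 (real n) \<le> real (C2 * (n + 1) ^ d2)"
      using real_poly_le_power by blast
    obtain C3 d3 where q: "\<And>n :: nat. poly p3 (real n) \<le> real (C3 * (n + 1) ^ d3)"
      using real_poly_le_power by blast
    have Z: "Zpar Q \<le> C1 * (n + 1) ^ d1" if Q: "Q \<in> A" "m_psi \<psi> Q \<le> n" for Q n
    proof -
      obtain y where y: "Z_fun \<psi> A n = Some y" "real y \<le> poly p1 (real n)" using p1 by blast
      have "Zpar Q \<le> y"
        by (rule max_if_finite_ge[OF y(1)[unfolded Z_fun_def]]) (use Q in \<open>auto simp: A_psi_def\<close>)
      moreover have "y \<le> C1 * (n + 1) ^ d1"
        using order_trans[OF y(2) z] of_nat_le_iff by blast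
      ultimately show ?thesis by simp
    qed
    have G: "Gpar Q \<le> C2 * (n + 1) ^ d2" if Q: "Q \<in> A" "m_psi \<psi> Q \<le> n" for Q n
    proof -
      obtain y where y: "G_fun \<psi> A n = Some y" "real y \<le> poly p2 (real n)" using p2 by blast
      have "Gpar Q \<le> y"
        by (rule max_if_finite_ge[OF y(1)[unfolded G_fun_def]]) (use Q in \<open>auto simp: A_psi_def\<close>)
      moreover have "y \<le> C2 * (n + 1) ^ d2"
        using order_trans[OF y(2) g] of_nat_le_iff by blast
      ultimately show ?thesis by simp
    qed
    have L: "l_psi \<psi> T n \<le> 2 ^ (C3 * (n + 1) ^ d3)" if T: "T \<in> A" for T n
    proof -
      obtain y where y: "L_fun \<psi> A n = Some y" "real y \<le> 2 powr poly p3 (real n)" using p3 by blast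
      have "l_psi \<psi> T n \<le> y"
        by (rule max_if_finite_ge[OF y(1)[unfolded L_fun_def]]) (use T in auto)
      moreover have "2 powr poly p3 (real n) \<le> 2 powr real (C3 * (n + 1) ^ d3)"
        using q by (intro powr_mono) simp_all
      moreover have "2 powr real (C3 * (n + 1) ^ d3) = real (2 ^ (C3 * (n + 1) ^ d3))"
        by (subst powr_realpow) simp_all
      ultimately show ?thesis using y(2) by (metis of_nat_le_iff order_trans)
    qed
    obtain q1 :: "real poly" where q1: "\<And>n. poly q1 (real n) = real (C1 * (n + 1) ^ d1)"
      using ex_nat_poly by blast
    obtain q2 :: "real poly" where q2: "\<And>n. poly q2 (real n) = real (C2 * (n + 1) ^ d2)"
      using ex_nat_poly by blast
    obtain q3 :: "real poly" where q3: "\<And>n. poly q3 (real n) = real (C3 * (n + 1) ^ d3)"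
      using ex_nat_poly by blast
    let ?X = "[:0, 1:] :: real poly"
    \<comment> \<open>The bound of \<open>psi_d_upper\<close> with \<open>z\<close>,
      \<open>g\<close> and \<open>q\<close> replaced by their polynomial bounds; a table attaining
      \<open>H n\<close> exists because the maximum is over a finite nonempty set.\<close>
    have "real (H n) \<le> poly (((?X + q3) * q1 + 1) * (q2 + ?X) * ?X) (real n)" for n
    proof -
      have "{T \<in> A. psi_a \<psi> T \<le> n} \<noteq> {}" using Lam by auto
      then have "H n \<in> psi_d \<psi> ` {T \<in> A. psi_a \<psi> T \<le> n}"
        using max_if_finite_mem[OF H_Some] by blast
      then obtain T where T: "T \<in> A" "psi_a \<psi> T \<le> n" "H n = psi_d \<psi> T" by blast
      have "psi_d \<psi> T \<le> (((n + C3 * (n + 1) ^ d3) * (C1 * (n + 1) ^ d1) + 1)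
          * (C2 * (n + 1) ^ d2 + n)) * n"
      proof (cases "rows T = {}")
        case True
        then show ?thesis by (simp add: psi_d_def)
      next
        case False
        show ?thesis by (rule psi_d_upper[OF A \<psi> T(1) False T(2) Z G L[OF T(1)]])
      qed
      then have "real (H n) \<le> real ((((n + C3 * (n + 1) ^ d3) * (C1 * (n + 1) ^ d1) + 1)
          * (C2 * (n + 1) ^ d2 + n)) * n)"
        unfolding T(3) by (rule of_nat_mono)
      also have "\<dots> = poly (((?X + q3) * q1 + 1) * (q2 + ?X) * ?X) (real n)"
        by (simp only: poly_mult poly_add q1 q2 q3 of_nat_mult of_nat_add of_nat_1 poly_1)
          (simp add: algebra_simps)
      finally show ?thesis .
    qed
    then show ?lhs unfolding H_def by blast
  qed
qed

end
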